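(* Let $(M,F)$ be a complex Finsler space of complex dimension $2$. Then one of the following holds: (i) $(M,F)$ is purely Hermitian; or (ii) $A$ is not identically zero, $B=0$ identically, and $$(J+Y)|_sm^s=\frac1F(V+H),\qquad (V+H)|_sm^s=-A(J+Y);$$ or (iii) $AB^2$ is not identically zero and $$(J+Y)|_0=\frac{J+Y}2,\qquad (V+H)|_0=-\frac{V+H}2,$$ $$B_{|k}=\Big[\frac B2(J+Y)+(J+Y)|_sm^s-\frac1F(V+H)\Big]l_k+\Big[B(V+H)+(V+H)|_sm^s+A(J+Y)\Big]m_k .$$ (The identities hold in every local chart, all quantities being computed in that chart.)
   Context: $M$ is a complex manifold with $\dim_{\mathbb C}M=2$; $T'M$ is its holomorphic tangent bundle with local coordinates $(z^k,\eta^k)_{k=1,2}$; $\widetilde{T'M}$ is $T'M$ minus the zero section. A complex Finsler space $(M,F)$: $F:T'M\to[0,\infty)$ is continuous, $L:=F^2$ is smooth on $\widetilde{T'M}$, $F(z,\eta)=0$ iff $\eta=0$, $F(z,\lambda\eta)=|\lambda|F(z,\eta)$ for all $\lambda\in\mathbb C$, and the Hermitian matrix $g_{i\bar j}:=\partial^2L/\partial\eta^i\partial\bar\eta^j$ is positive definite on $\widetilde{T'M}$. Repeated indices are summed over $\{1,2\}$; everything lives on $\widetilde{T'M}$. $(g^{\bar m i})$ is the inverse matrix: $g^{\bar m i}g_{j\bar m}=\delta^i_j$. $(M,F)$ is purely Hermitian if $g_{i\bar j}=g_{i\bar j}(z)$ does not depend on $\eta$. Chern–Finsler connection: $\dot\partial_k:=\partial/\partial\eta^k$,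 $N^k_j:=g^{\bar mk}\frac{\partial g_{l\bar m}}{\partial z^j}\eta^l$, $\delta_k:=\frac{\partial}{\partial z^k}-N^j_k\dot\partial_j$, $L^i_{jk}:=g^{\bar li}\delta_kg_{j\bar l}$, $C^i_{jk}:=g^{\bar li}\dot\partial_kg_{j\bar l}$. In a fixed local chart: $l^i:=\eta^i/F$, $l_i:=\frac1Fg_{i\bar j}\bar\eta^j$, $g:=\det(g_{i\bar j})$, $m^1:=-l_2/\sqrt g$, $m^2:=l_1/\sqrt g$, $m_1:=-\sqrt g\,l^2$, $m_2:=\sqrt g\,l^1$. Put $A:=m^jm^kl_hC^h_{kj}$, $B:=m_hm^km^jC^h_{jk}$ (whether $A$ or $B$ vanishes at a point does not depend on the chart), and $J:=l^jl^kl_iL^i_{jk}$, $Y:=m^jl^km_iL^i_{jk}$, $V:=l^jm^kl_iL^i_{jk}$, $H:=m^jm^km_iL^i_{jk}$. For a function $f$: $f_{|k}:=\delta_kf$, $f|_k:=\dot\partial_kf$, $f|_0:=\eta^k\dot\partial_kf$, $f|_sm^s:=m^s\dot\partial_sf$. *)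

theory Defs
  imports "HOL-Analysis.Analysis"
begin

section \<open>Complex manifolds and the holomorphic tangent bundle\<close>

definition holomorphic_map_on :: "(complex^'n) set \<Rightarrow> (complex^'n \<Rightarrow> complex^'n) \<Rightarrow> bool" where
  "holomorphic_map_on S f \<longleftrightarrow>
     (\<forall>x\<in>S. \<exists>D. (f has_derivative D) (at x) \<and> (\<forall>c v. D (c *s v) = c *s D v))"

text \<open>A chart is a coordinate domain together with a coordinate map. The values of the map outside
  the domain are irrelevant.\<close>

type_synonym ('a, 'n) chart = "'a set \<times> ('a \<Rightarrow> complex^'n)"

definition chart_image :: "('a, 'n::finite) chart \<Rightarrow> (complex^'n) set" where
  "chart_image c = snd c ` fst c"

definition chart_inv :: "('a, 'n::finite) chart \<Rightarrow> complex^'n \<Rightarrow> 'a" where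
  "chart_inv c = inv_into (fst c) (snd c)"

definition transition :: "('a, 'n::finite) chart \<Rightarrow> ('a, 'n) chart \<Rightarrow> complex^'n \<Rightarrow> complex^'n" where
  "transition c d z = snd d (chart_inv c z)"

definition is_chart :: "'a topology \<Rightarrow> ('a, 'n::finite) chart \<Rightarrow> bool" where
  "is_chart X c \<longleftrightarrow> openin X (fst c) \<and> open (chart_image c) \<and>
     homeomorphic_map (subtopology X (fst c)) (top_of_set (chart_image c)) (snd c)"

definition compatible_charts :: "('a, 'n::finite) chart \<Rightarrow> ('a, 'n) chart \<Rightarrow> bool" where
  "compatible_charts c d \<longleftrightarrow>
     holomorphic_map_on (snd c ` (fst c \<inter> fst d)) (transition c d) \<and>
     holomorphic_map_on (snd d ` (fst c \<inter> fst d)) (transition d c)"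

text \<open>The complex structure is a maximal holomorphic atlas, so that membership in it means
  being an arbitrary local chart of the manifold. The complex dimension is \<open>CARD('n)\<close>.\<close>

locale complex_manifold =
  fixes X :: "'a topology" and \<A> :: "('a, 'n::finite) chart set"
  assumes hausdorff: "Hausdorff_space X"
    and countable_base: "second_countable X"
    and charts: "c \<in> \<A> \<Longrightarrow> is_chart X c"
    and cover: "topspace X = (\<Union>c\<in>\<A>. fst c)"
    and compatible: "c \<in> \<A> \<Longrightarrow> d \<in> \<A> \<Longrightarrow> compatible_charts c d"
    and maximal: "is_chart X c \<Longrightarrow> (\<And>d. d \<in> \<A> \<Longrightarrow> compatible_charts c d) \<Longrightarrow> c \<in> \<A>"

text \<open>A holomorphic tangent vector at \<open>p\<close> assigns to every chart around \<open>p\<close> its component vector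
  with respect to the coordinate fields \<open>\<partial>/\<partial>z\<^sup>k\<close> of that chart; components in different charts are
  related by the (complex linear) derivative of the transition map. Charts not containing \<open>p\<close>
  receive the dummy value \<open>0\<close>.\<close>

type_synonym ('a, 'n) tangent = "'a \<times> (('a, 'n) chart \<Rightarrow> complex^'n)"

definition tangent_space ::
    "('a, 'n::finite) chart set \<Rightarrow> 'a \<Rightarrow> (('a, 'n) chart \<Rightarrow> complex^'n) set" where
  "tangent_space \<A> p = {v.
     (\<forall>c\<in>\<A>. \<forall>d\<in>\<A>. p \<in> fst c \<longrightarrow> p \<in> fst d \<longrightarrow>
        v d = frechet_derivative (transition c d) (at (snd c p)) (v c)) \<and>
     (\<forall>c. \<not> (c \<in> \<A> \<and> p \<in> fst c) \<longrightarrow> v c = 0)}"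

definition tangent_bundle :: "'a topology \<Rightarrow> ('a, 'n::finite) chart set \<Rightarrow> ('a, 'n) tangent set" where
  "tangent_bundle X \<A> = (SIGMA p:topspace X. tangent_space \<A> p)"

text \<open>The inverse of the induced chart \<open>(z, \<eta>)\<close> of the tangent bundle: the point with coordinates
  \<open>z\<close> and the tangent vector there with components \<open>\<eta>\<close> in the chart \<open>c\<close>.\<close>

definition induced_param ::
    "('a, 'n::finite) chart set \<Rightarrow> ('a, 'n) chart \<Rightarrow> (complex^'n) \<times> (complex^'n) \<Rightarrow> ('a, 'n) tangent" where
  "induced_param \<A> c = (\<lambda>(z, \<eta>). (chart_inv c z,
     \<lambda>d. if d \<in> \<A> \<and> chart_inv c z \<in> fst d then frechet_derivative (transition c d) (at z) \<eta> else 0))"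

lemma (in complex_manifold) induced_param_bij:
  assumes c: "c \<in> \<A>"
  shows "bij_betw (induced_param \<A> c) (chart_image c \<times> UNIV) {q \<in> tangent_bundle X \<A>. fst q \<in> fst c}"
proof -
  have inj: "inj_on (snd d) (fst d)" and sub: "fst d \<subseteq> topspace X" if "d \<in> \<A>" for d
    using charts[OF that] by (auto simp: is_chart_def homeomorphic_map_def openin_subset Int_absorb1)
  have inv: "chart_inv d (snd d p) = p" if "d \<in> \<A>" "p \<in> fst d" for d p
    using inj[OF that(1)] that(2) by (simp add: chart_inv_def)
  have op: "open (snd d ` (fst d \<inter> fst e))" if "d \<in> \<A>" "e \<in> \<A>" for d e
  proof -
    have "homeomorphic_map (subtopology X (fst d)) (top_of_set (chart_image d)) (snd d)"
      "openin (subtopology X (fst d)) (fst d \<inter> fst e)"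
      using charts[OF that(1)] charts[OF that(2)]
      by (auto simp: is_chart_def openin_subtopology Int_commute)
    then have "openin (top_of_set (chart_image d)) (snd d ` (fst d \<inter> fst e))"
      by (metis homeomorphic_map_openness_eq)
    then show ?thesis
      using charts[OF that(1)] openin_open_trans[of "chart_image d"] by (simp add: is_chart_def)
  qed
  have der: "(transition d e has_derivative frechet_derivative (transition d e) (at (snd d p)))
      (at (snd d p))" if "d \<in> \<A>" "e \<in> \<A>" "p \<in> fst d" "p \<in> fst e" for d e p
  proof -
    have "snd d p \<in> snd d ` (fst d \<inter> fst e)" using that by blast
    with compatible[OF that(1,2)] obtain D where "(transition d e has_derivative D) (at (snd d p))"
      unfolding compatible_charts_def holomorphic_map_on_def by blast
    then show ?thesis using frechet_derivative_at by fastforce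
  qed
  have chain: "frechet_derivative (transition c e) (at (snd c p)) \<eta> =
      frechet_derivative (transition d e) (at (snd d p))
        (frechet_derivative (transition c d) (at (snd c p)) \<eta>)"
    if "d \<in> \<A>" "e \<in> \<A>" "p \<in> fst c" "p \<in> fst d" "p \<in> fst e" for d e p \<eta>
  proof -
    have t: "transition c d (snd c p) = snd d p"
      using inv[OF c] that by (simp add: transition_def)
    have "((transition d e \<circ> transition c d) has_derivative
        frechet_derivative (transition d e) (at (snd d p)) \<circ>
        frechet_derivative (transition c d) (at (snd c p))) (at (snd c p))"
      using diff_chain_at[OF der[OF c that(1,3,4)]] der[OF that(1,2,4,5)] t by simp
    then have "(transition c e has_derivative
        frechet_derivative (transition d e) (at (snd d p)) \<circ>
        frechet_derivative (transition c d) (at (snd c p))) (at (snd c p))"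
    proof (rule has_derivative_transform_within_open[OF _ op[OF c that(1)]])
      show "snd c p \<in> snd c ` (fst c \<inter> fst d)" using that by auto
      show "(transition d e \<circ> transition c d) x = transition c e x"
        if "x \<in> snd c ` (fst c \<inter> fst d)" for x
        using that inv[OF c] inv[OF \<open>d \<in> \<A>\<close>] unfolding transition_def by fastforce
    qed
    from frechet_derivative_at[OF this, symmetric] show ?thesis by simp
  qed
  have self: "frechet_derivative (transition c c) (at (snd c p)) \<eta> = \<eta>" if "p \<in> fst c" for p \<eta>
  proof -
    have "(transition c c has_derivative id) (at (snd c p))"
      by (rule has_derivative_transform_within_open[OF has_derivative_id op[OF c c]])
        (use that inv[OF c] in \<open>auto simp: transition_def\<close>)
    from frechet_derivative_at[OF this, symmetric] show ?thesis by simp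
  qed
  define G where "G = (\<lambda>(p, v). (snd c p, v c :: complex^'n))"
  show ?thesis
  proof (rule bij_betw_byWitness[where f' = G])
    show "\<forall>w\<in>chart_image c \<times> UNIV. G (induced_param \<A> c w) = w"
    proof
      fix w assume "w \<in> chart_image c \<times> (UNIV :: (complex^'n) set)"
      then obtain p \<eta> where w: "w = (snd c p, \<eta>)" and p: "p \<in> fst c"
        by (auto simp: chart_image_def)
      then show "G (induced_param \<A> c w) = w"
        using inv[OF c p] self[OF p] c by (simp add: G_def induced_param_def)
    qed
    show "\<forall>q\<in>{q \<in> tangent_bundle X \<A>. fst q \<in> fst c}. induced_param \<A> c (G q) = q"
    proof clarify
      fix p v assume a: "(p, v) \<in> tangent_bundle X \<A>" "fst (p, v) \<in> fst c"
      have "(if d \<in> \<A> \<and> p \<in> fst d then frechet_derivative (transition c d) (at (snd c p)) (v c) else 0)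
          = v d" for d
      proof -
        have "d \<in> \<A> \<Longrightarrow> p \<in> fst d \<Longrightarrow>
            v d = frechet_derivative (transition c d) (at (snd c p)) (v c)"
          "\<not> (d \<in> \<A> \<and> p \<in> fst d) \<Longrightarrow> v d = 0"
          using a c unfolding tangent_bundle_def tangent_space_def mem_Sigma_iff mem_Collect_eq fst_conv
          by blast+
        then show ?thesis by presburger
      qed
      then show "induced_param \<A> c (G (p, v)) = (p, v)"
        using inv[OF c, of p] a(2) by (simp add: induced_param_def G_def)
    qed
    show "induced_param \<A> c ` (chart_image c \<times> UNIV) \<subseteq> {q \<in> tangent_bundle X \<A>. fst q \<in> fst c}"
    proof (rule image_subsetI)
      fix w assume "w \<in> chart_image c \<times> (UNIV :: (complex^'n) set)"
      then obtain p \<eta> where w: "w = (snd c p, \<eta>)" and p: "p \<in> fst c"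
        by (auto simp: chart_image_def)
      define v where "v = (\<lambda>d. if d \<in> \<A> \<and> p \<in> fst d
        then frechet_derivative (transition c d) (at (snd c p)) \<eta> else 0)"
      have "v e = frechet_derivative (transition d e) (at (snd d p)) (v d)"
        if "d \<in> \<A>" "e \<in> \<A>" "p \<in> fst d" "p \<in> fst e" for d e
        using chain[OF that(1,2) p that(3,4)] that by (simp add: v_def)
      moreover have "v d = 0" if "\<not> (d \<in> \<A> \<and> p \<in> fst d)" for d
        using that by (auto simp: v_def)
      ultimately have "v \<in> tangent_space \<A> p"
        unfolding tangent_space_def mem_Collect_eq
        by (intro conjI ballI allI impI) blast+
      moreover have "induced_param \<A> c w = (p, v)"
        using inv[OF c p] by (simp add: w v_def induced_param_def)
      ultimately show "induced_param \<A> c w \<in> {q \<in> tangent_bundle X \<A>. fst q \<in> fst c}"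
        using p sub[OF c] by (auto simp: tangent_bundle_def)
    qed
    show "G ` {q \<in> tangent_bundle X \<A>. fst q \<in> fst c} \<subseteq> chart_image c \<times> UNIV"
      unfolding G_def chart_image_def by (rule image_subsetI) (simp add: case_prod_unfold)
  qed
qed

definition tangent_openin ::
    "'a topology \<Rightarrow> ('a, 'n::finite) chart set \<Rightarrow> ('a, 'n) tangent set \<Rightarrow> bool" where
  "tangent_openin X \<A> S \<longleftrightarrow> S \<subseteq> tangent_bundle X \<A> \<and>
     (\<forall>c\<in>\<A>. open {w \<in> chart_image c \<times> UNIV. induced_param \<A> c w \<in> S})"

lemma istopology_tangent_openin: "istopology (tangent_openin X \<A>)"
proof -
  have "tangent_openin X \<A> (S \<inter> T)" if "tangent_openin X \<A> S" "tangent_openin X \<A> T" for S T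
  proof -
    have "{w \<in> chart_image c \<times> UNIV. induced_param \<A> c w \<in> S \<inter> T} =
        {w \<in> chart_image c \<times> UNIV. induced_param \<A> c w \<in> S} \<inter>
        {w \<in> chart_image c \<times> UNIV. induced_param \<A> c w \<in> T}" for c
      by auto
    with that show ?thesis
      unfolding tangent_openin_def by (simp only: open_Int) blast
  qed
  moreover have "tangent_openin X \<A> (\<Union>\<K>)" if "\<And>K. K \<in> \<K> \<Longrightarrow> tangent_openin X \<A> K" for \<K>
  proof -
    have "{w \<in> chart_image c \<times> UNIV. induced_param \<A> c w \<in> \<Union>\<K>} =
        (\<Union>K\<in>\<K>. {w \<in> chart_image c \<times> UNIV. induced_param \<A> c w \<in> K})" for c
      by auto
    moreover have "open (\<Union>K\<in>\<K>. {w \<in> chart_image c \<times> UNIV. induced_param \<A> c w \<in> K})"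
      if "c \<in> \<A>" for c
      using that \<open>\<And>K. K \<in> \<K> \<Longrightarrow> tangent_openin X \<A> K\<close>
      unfolding tangent_openin_def by blast
    moreover have "\<Union>\<K> \<subseteq> tangent_bundle X \<A>"
      using that unfolding tangent_openin_def by blast
    ultimately show ?thesis
      unfolding tangent_openin_def by simp
  qed
  ultimately show ?thesis
    unfolding istopology_def by blast
qed

definition tangent_topology ::
    "'a topology \<Rightarrow> ('a, 'n::finite) chart set \<Rightarrow> ('a, 'n) tangent topology" where
  "tangent_topology X \<A> = topology (tangent_openin X \<A>)"

text \<open>The range of the induced chart on the tangent bundle without its zero section.\<close>

definition slit_coords :: "('a, 'n::finite) chart \<Rightarrow> ((complex^'n) \<times> (complex^'n)) set" where
  "slit_coords c = chart_image c \<times> (UNIV - {0})"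


section \<open>Smoothness and Wirtinger derivatives\<close>

text \<open>On an open set of a finite-dimensional space \<open>Ck_on k\<close> is real \<open>C\<^sup>k\<close>: existence and continuity
  of all iterated directional derivatives up to order \<open>k\<close>.\<close>

primrec Ck_on :: "nat \<Rightarrow> 'a::real_normed_vector set \<Rightarrow> ('a \<Rightarrow> 'b::real_normed_vector) \<Rightarrow> bool" where
  "Ck_on 0 S f \<longleftrightarrow> continuous_on S f"
| "Ck_on (Suc k) S f \<longleftrightarrow> (\<forall>x\<in>S. f differentiable (at x)) \<and>
     (\<forall>v. Ck_on k S (\<lambda>x. frechet_derivative f (at x) v))"

definition smooth_on :: "'a::real_normed_vector set \<Rightarrow> ('a \<Rightarrow> 'b::real_normed_vector) \<Rightarrow> bool" where
  "smooth_on S f \<longleftrightarrow> (\<forall>k. Ck_on k S f)"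

type_synonym 'n coord_fun = "(complex^'n) \<times> (complex^'n) \<Rightarrow> complex"

text \<open>\<open>\<partial>/\<partial>z\<^sup>k = (\<partial>/\<partial>x\<^sup>k - \<i> \<partial>/\<partial>y\<^sup>k) / 2\<close>, and likewise for the fibre coordinates \<open>\<eta>\<^sup>k\<close>.\<close>

definition d_z :: "'n::finite \<Rightarrow> 'n coord_fun \<Rightarrow> 'n coord_fun" where
  "d_z k f w = (frechet_derivative f (at w) (axis k 1, 0) -
     \<i> * frechet_derivative f (at w) (axis k \<i>, 0)) / 2"

definition d_eta :: "'n::finite \<Rightarrow> 'n coord_fun \<Rightarrow> 'n coord_fun" where
  "d_eta k f w = (frechet_derivative f (at w) (0, axis k 1) -
     \<i> * frechet_derivative f (at w) (0, axis k \<i>)) / 2"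

definition d_etabar :: "'n::finite \<Rightarrow> 'n coord_fun \<Rightarrow> 'n coord_fun" where
  "d_etabar k f w = (frechet_derivative f (at w) (0, axis k 1) +
     \<i> * frechet_derivative f (at w) (0, axis k \<i>)) / 2"


section \<open>Complex Finsler spaces\<close>

text \<open>In the local formulas \<open>f\<close> is the coordinate expression of the Finsler function in a chart
  and \<open>w = (z, \<eta>)\<close>. \<open>fund_tensor f i j\<close> is \<open>g\<^sub>i\<^sub>j\<close> with barred second index.\<close>

definition fund_tensor :: "((complex^'n::finite) \<times> (complex^'n) \<Rightarrow> real) \<Rightarrow> 'n \<Rightarrow> 'n \<Rightarrow> 'n coord_fun" where
  "fund_tensor f i j = d_eta i (d_etabar j (\<lambda>w. complex_of_real ((f w)\<^sup>2)))"

definition fund_matrix :: "((complex^'n::finite) \<times> (complex^'n) \<Rightarrow> real) \<Rightarrow>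
    (complex^'n) \<times> (complex^'n) \<Rightarrow> complex^'n^'n" where
  "fund_matrix f w = (\<chi> i j. fund_tensor f i j w)"

definition hermitian_pos_def :: "complex^'n^'n \<Rightarrow> bool" where
  "hermitian_pos_def G \<longleftrightarrow> (\<forall>i j. G $ j $ i = cnj (G $ i $ j)) \<and>
     (\<forall>v. v \<noteq> 0 \<longrightarrow> 0 < Re (\<Sum>i\<in>UNIV. \<Sum>j\<in>UNIV. G $ i $ j * v $ i * cnj (v $ j)))"

definition local_expr :: "('a, 'n::finite) chart set \<Rightarrow> (('a, 'n) tangent \<Rightarrow> real) \<Rightarrow> ('a, 'n) chart \<Rightarrow>
    (complex^'n) \<times> (complex^'n) \<Rightarrow> real" where
  "local_expr \<A> F c = F \<circ> induced_param \<A> c"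

locale complex_finsler_space = complex_manifold X \<A>
  for X :: "'a topology" and \<A> :: "('a, 'n::finite) chart set" +
  fixes F :: "('a, 'n) tangent \<Rightarrow> real"
  assumes nonneg: "q \<in> tangent_bundle X \<A> \<Longrightarrow> 0 \<le> F q"
    and continuous: "continuous_map (tangent_topology X \<A>) euclideanreal F"
    and smooth: "c \<in> \<A> \<Longrightarrow> smooth_on (slit_coords c) (\<lambda>w. (local_expr \<A> F c w)\<^sup>2)"
    and zero_iff: "(p, v) \<in> tangent_bundle X \<A> \<Longrightarrow> F (p, v) = 0 \<longleftrightarrow> v = (\<lambda>_. 0)"
    and homogeneous: "(p, v) \<in> tangent_bundle X \<A> \<Longrightarrow>
      F (p, \<lambda>c. a *s v c) = cmod a * F (p, v)"
    and pos_def: "c \<in> \<A> \<Longrightarrow> w \<in> slit_coords c \<Longrightarrow>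
      hermitian_pos_def (fund_matrix (local_expr \<A> F c) w)"

definition purely_hermitian :: "('a, 'n::finite) chart set \<Rightarrow> (('a, 'n) tangent \<Rightarrow> real) \<Rightarrow> bool" where
  "purely_hermitian \<A> F \<longleftrightarrow> (\<forall>c\<in>\<A>. \<forall>z \<eta> \<eta>'. (z, \<eta>) \<in> slit_coords c \<longrightarrow> (z, \<eta>') \<in> slit_coords c \<longrightarrow>
     fund_matrix (local_expr \<A> F c) (z, \<eta>) = fund_matrix (local_expr \<A> F c) (z, \<eta>'))"


section \<open>The Chern--Finsler connection\<close>

text \<open>\<open>g_inv f m i\<close> is the inverse tensor with barred first index: the relation
  \<open>\<Sum>m. fund_tensor f j m w * g_inv f m i w = (if i = j then 1 else 0)\<close> is matrix inversion in the
  given order of indices.\<close>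

definition g_inv :: "((complex^'n::finite) \<times> (complex^'n) \<Rightarrow> real) \<Rightarrow> 'n \<Rightarrow> 'n \<Rightarrow> 'n coord_fun" where
  "g_inv f m i w = matrix_inv (fund_matrix f w) $ m $ i"

text \<open>\<open>N_conn f k j\<close> is \<open>N\<^sup>k\<^sub>j\<close>; \<open>L_conn f i j k\<close> is \<open>L\<^sup>i\<^sub>j\<^sub>k\<close>; \<open>C_conn f i j k\<close> is \<open>C\<^sup>i\<^sub>j\<^sub>k\<close>.\<close>

definition N_conn :: "((complex^'n::finite) \<times> (complex^'n) \<Rightarrow> real) \<Rightarrow> 'n \<Rightarrow> 'n \<Rightarrow> 'n coord_fun" where
  "N_conn f k j w =
     (\<Sum>m\<in>UNIV. \<Sum>l\<in>UNIV. g_inv f m k w * d_z j (fund_tensor f l m) w * snd w $ l)"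

definition delta_h :: "((complex^'n::finite) \<times> (complex^'n) \<Rightarrow> real) \<Rightarrow> 'n \<Rightarrow> 'n coord_fun \<Rightarrow> 'n coord_fun" where
  "delta_h f k u w = d_z k u w - (\<Sum>j\<in>UNIV. N_conn f j k w * d_eta j u w)"

definition L_conn :: "((complex^'n::finite) \<times> (complex^'n) \<Rightarrow> real) \<Rightarrow> 'n \<Rightarrow> 'n \<Rightarrow> 'n \<Rightarrow> 'n coord_fun" where
  "L_conn f i j k w = (\<Sum>l\<in>UNIV. g_inv f l i w * delta_h f k (fund_tensor f j l) w)"

definition C_conn :: "((complex^'n::finite) \<times> (complex^'n) \<Rightarrow> real) \<Rightarrow> 'n \<Rightarrow> 'n \<Rightarrow> 'n \<Rightarrow> 'n coord_fun" where
  "C_conn f i j k w = (\<Sum>l\<in>UNIV. g_inv f l i w * d_eta k (fund_tensor f j l) w)"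

definition l_up :: "((complex^'n::finite) \<times> (complex^'n) \<Rightarrow> real) \<Rightarrow> 'n \<Rightarrow> 'n coord_fun" where
  "l_up f i w = snd w $ i / complex_of_real (f w)"

definition l_dn :: "((complex^'n::finite) \<times> (complex^'n) \<Rightarrow> real) \<Rightarrow> 'n \<Rightarrow> 'n coord_fun" where
  "l_dn f i w = (\<Sum>j\<in>UNIV. fund_tensor f i j w * cnj (snd w $ j)) / complex_of_real (f w)"

definition deriv_0 :: "'n::finite coord_fun \<Rightarrow> 'n coord_fun" where
  "deriv_0 u w = (\<Sum>k\<in>UNIV. snd w $ k * d_eta k u w)"


section \<open>The local frame in complex dimension two\<close>

text \<open>The determinant of the fundamental matrix is a positive real number, so \<open>csqrt\<close> is its
  positive square root.\<close>

definition sqrt_g :: "((complex^2) \<times> (complex^2) \<Rightarrow> real) \<Rightarrow> 2 coord_fun" where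
  "sqrt_g f w = csqrt (det (fund_matrix f w))"

definition m_up :: "((complex^2) \<times> (complex^2) \<Rightarrow> real) \<Rightarrow> 2 \<Rightarrow> 2 coord_fun" where
  "m_up f i w = (if i = 1 then - l_dn f 2 w / sqrt_g f w else l_dn f 1 w / sqrt_g f w)"

definition m_dn :: "((complex^2) \<times> (complex^2) \<Rightarrow> real) \<Rightarrow> 2 \<Rightarrow> 2 coord_fun" where
  "m_dn f i w = (if i = 1 then - sqrt_g f w * l_up f 2 w else sqrt_g f w * l_up f 1 w)"

definition fin_A :: "((complex^2) \<times> (complex^2) \<Rightarrow> real) \<Rightarrow> 2 coord_fun" where
  "fin_A f w = (\<Sum>j\<in>UNIV. \<Sum>k\<in>UNIV. \<Sum>h\<in>UNIV.
     m_up f j w * m_up f k w * l_dn f h w * C_conn f h k j w)"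

definition fin_B :: "((complex^2) \<times> (complex^2) \<Rightarrow> real) \<Rightarrow> 2 coord_fun" where
  "fin_B f w = (\<Sum>h\<in>UNIV. \<Sum>k\<in>UNIV. \<Sum>j\<in>UNIV.
     m_dn f h w * m_up f k w * m_up f j w * C_conn f h j k w)"

definition fin_J :: "((complex^2) \<times> (complex^2) \<Rightarrow> real) \<Rightarrow> 2 coord_fun" where
  "fin_J f w = (\<Sum>j\<in>UNIV. \<Sum>k\<in>UNIV. \<Sum>i\<in>UNIV.
     l_up f j w * l_up f k w * l_dn f i w * L_conn f i j k w)"

definition fin_Y :: "((complex^2) \<times> (complex^2) \<Rightarrow> real) \<Rightarrow> 2 coord_fun" where
  "fin_Y f w = (\<Sum>j\<in>UNIV. \<Sum>k\<in>UNIV. \<Sum>i\<in>UNIV.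
     m_up f j w * l_up f k w * m_dn f i w * L_conn f i j k w)"

definition fin_V :: "((complex^2) \<times> (complex^2) \<Rightarrow> real) \<Rightarrow> 2 coord_fun" where
  "fin_V f w = (\<Sum>j\<in>UNIV. \<Sum>k\<in>UNIV. \<Sum>i\<in>UNIV.
     l_up f j w * m_up f k w * l_dn f i w * L_conn f i j k w)"

definition fin_H :: "((complex^2) \<times> (complex^2) \<Rightarrow> real) \<Rightarrow> 2 coord_fun" where
  "fin_H f w = (\<Sum>j\<in>UNIV. \<Sum>k\<in>UNIV. \<Sum>i\<in>UNIV.
     m_up f j w * m_up f k w * m_dn f i w * L_conn f i j k w)"

definition fin_JY :: "((complex^2) \<times> (complex^2) \<Rightarrow> real) \<Rightarrow> 2 coord_fun" where
  "fin_JY f w = fin_J f w + fin_Y f w"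

definition fin_VH :: "((complex^2) \<times> (complex^2) \<Rightarrow> real) \<Rightarrow> 2 coord_fun" where
  "fin_VH f w = fin_V f w + fin_H f w"

definition deriv_m :: "((complex^2) \<times> (complex^2) \<Rightarrow> real) \<Rightarrow> 2 coord_fun \<Rightarrow> 2 coord_fun" where
  "deriv_m f u w = (\<Sum>s\<in>UNIV. m_up f s w * d_eta s u w)"

end

(* Write L_k for the trace L^i_{ik}, which is the delta_k-derivative of ln g. Completeness of the frame
   (l, m) gives J + Y = l^k L_k and V + H = m^k L_k, that is, L_k = (J + Y) l_k + (V + H) m_k, and
   homogeneity gives that the fibre derivative of ln g along eta^j is B m_j and that of L = F^2 along
   eta^j and eta^k is F A m_j m_k. Differentiating B m_j by delta_k, with the commutator of delta_k and
   the fibre derivatives and L^i_{jk} = d N^i_k / d eta^j, yields B_{|k} = L_k|_s m^s + B L_k / 2;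
   expanding L_k in the coframe turns this into the equation for B_{|k} of case (iii), which therefore
   holds in every complex Finsler space, as do the two homogeneity identities. If B vanishes, the
   equation reduces to the two identities of case (ii). If A vanishes on an open set, then so does the
   fibre derivative of the fundamental tensor, and with it B: hence A = 0 everywhere forces a purely
   Hermitian metric, and a point with B nonzero has points nearby where both A and B are nonzero. *)

theory Submission
  imports Defs
begin


section \<open>Smooth functions on open sets\<close>

text \<open>F^2 is only real smooth, so all derivatives are Wirtinger combinations of real Frechet
  derivatives. At a fixed point these combinations, \<open>delta_h\<close>, \<open>deriv_0\<close>
  and \<open>deriv_m\<close> all obey the Leibniz rule. The differentiation rules, including those
  for the square roots F and sqrt g, are therefore proved once for an abstract derivation. The
  factor 1/2 in B L_k / 2 comes from the sqrt g inside m_j. After contraction with m^j, the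
  delta_k-derivative of m_j gives L_k / 2 minus the l-part of the trace of d N^i_k / d eta^j, and
  the commutator gives the m-part. The two parts add up to L_k, which leaves B (L_k - L_k / 2). The
  same root puts B m_k / 2 into m_k|_s m^s, which is why case (iii) has B (V + H) but only B (J + Y)
  / 2.\<close>

lemma frechet_derivative_cong_open:
  assumes "open S" "x \<in> S" "\<And>y. y \<in> S \<Longrightarrow> f y = g y"
  shows "frechet_derivative f (at x) = frechet_derivative g (at x)"
proof -
  \<comment> \<open>\<open>frechet_derivative\<close> is a choice among the derivatives at the
    point. Equal sets of candidates give equal choices, even where no derivative exists.\<close>
  have "(f has_derivative D) (at x) \<longleftrightarrow> (g has_derivative D) (at x)" for D
    using has_derivative_transform_within_open[of f D x UNIV S g]
      has_derivative_transform_within_open[of g D x UNIV S f] assms by auto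
  then show ?thesis
    by (simp add: frechet_derivative_def)
qed

lemma differentiable_cong_open:
  assumes "open S" "x \<in> S" "\<And>y. y \<in> S \<Longrightarrow> f y = g y" "f differentiable (at x)"
  shows "g differentiable (at x)"
  using assms has_derivative_transform_within_open[of f _ x UNIV S g]
  unfolding differentiable_def by blast

lemma Ck_on_cong:
  assumes "open S" "\<And>x. x \<in> S \<Longrightarrow> f x = g x" "Ck_on k S f"
  shows "Ck_on k S g"
  using assms
proof (induction k arbitrary: f g)
  case 0
  then show ?case by (simp cong: continuous_on_cong)
next
  case (Suc k)
  have "g differentiable (at x)" if "x \<in> S" for x
    using differentiable_cong_open[OF Suc.prems(1) that, of f g] Suc.prems that by simp
  moreover have "Ck_on k S (\<lambda>x. frechet_derivative g (at x) v)" for v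
  proof (rule Suc.IH[OF Suc.prems(1)])
    show "frechet_derivative f (at x) v = frechet_derivative g (at x) v" if "x \<in> S" for x
      using frechet_derivative_cong_open[OF Suc.prems(1) that, of f g] Suc.prems(2) by simp
    show "Ck_on k S (\<lambda>x. frechet_derivative f (at x) v)"
      using Suc.prems(3) by simp
  qed
  ultimately show ?case by simp
qed

lemma Ck_on_SucD: "Ck_on (Suc k) S f \<Longrightarrow> Ck_on k S f"
proof (induction k arbitrary: f)
  case 0
  then show ?case
    by (auto intro!: continuous_at_imp_continuous_on differentiable_imp_continuous_within)
next
  case (Suc k)
  from Suc.prems have "\<forall>x\<in>S. f differentiable (at x)"
    "\<And>v. Ck_on (Suc k) S (\<lambda>x. frechet_derivative f (at x) v)"
    unfolding Ck_on.simps(2)[of "Suc k"] by blast+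
  then show ?case
    using Suc.IH unfolding Ck_on.simps(2)[of k S f] by blast
qed

lemma smooth_on_cong:
  assumes "open S" "\<And>x. x \<in> S \<Longrightarrow> f x = g x" "smooth_on S f"
  shows "smooth_on S g"
  using assms Ck_on_cong unfolding smooth_on_def by blast

lemma smooth_on_imp_differentiable: "smooth_on S f \<Longrightarrow> x \<in> S \<Longrightarrow> f differentiable (at x)"
  unfolding smooth_on_def by (metis Ck_on.simps(2))

lemma smooth_on_imp_continuous: "smooth_on S f \<Longrightarrow> continuous_on S f"
  unfolding smooth_on_def by (metis Ck_on.simps(1))

lemma smooth_on_frechet: "smooth_on S f \<Longrightarrow> smooth_on S (\<lambda>x. frechet_derivative f (at x) v)"
  unfolding smooth_on_def by (metis Ck_on.simps(2))

lemma Ck_on_const: "Ck_on k S (\<lambda>x. c)"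
proof (induction k arbitrary: c)
  case (Suc k)
  then show ?case by (simp add: frechet_derivative_const)
qed simp

lemma smooth_on_const: "smooth_on S (\<lambda>x. c)"
  by (simp add: smooth_on_def Ck_on_const)

lemma frechet_derivative_linear_comp:
  assumes "bounded_linear L" "f differentiable (at x)"
  shows "frechet_derivative (\<lambda>y. L (f y)) (at x) v = L (frechet_derivative f (at x) v)"
proof -
  have "((\<lambda>y. L (f y)) has_derivative (\<lambda>v. L (frechet_derivative f (at x) v))) (at x)"
    using assms bounded_linear.has_derivative frechet_derivative_works by blast
  from frechet_derivative_at[OF this, symmetric] show ?thesis by simp
qed

lemma Ck_on_linear_comp:
  assumes "open S" "bounded_linear L" "Ck_on k S f"
  shows "Ck_on k S (\<lambda>x. L (f x))"
  using assms(3)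
proof (induction k arbitrary: f)
  case 0
  then show ?case using assms(2) by (simp add: bounded_linear.continuous_on)
next
  case (Suc k)
  have "(\<lambda>x. L (f x)) differentiable (at x)" if "x \<in> S" for x
    using Suc.prems that bounded_linear.has_derivative[OF assms(2)] unfolding differentiable_def
    by (fastforce simp: differentiable_def)
  moreover have "Ck_on k S (\<lambda>x. frechet_derivative (\<lambda>y. L (f y)) (at x) v)" for v
  proof (rule Ck_on_cong[OF assms(1)])
    show "Ck_on k S (\<lambda>x. L (frechet_derivative f (at x) v))"
      using Suc by simp
    show "L (frechet_derivative f (at x) v) = frechet_derivative (\<lambda>y. L (f y)) (at x) v"
      if "x \<in> S" for x
      using frechet_derivative_linear_comp[OF assms(2), of f x v] Suc.prems that by simp
  qed
  ultimately show ?case by simp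
qed

lemma smooth_on_linear_comp:
  "open S \<Longrightarrow> bounded_linear L \<Longrightarrow> smooth_on S f \<Longrightarrow> smooth_on S (\<lambda>x. L (f x))"
  by (simp add: smooth_on_def Ck_on_linear_comp)

lemma smooth_on_bounded_linear:
  assumes "open S" "bounded_linear L"
  shows "smooth_on S L"
proof -
  have L: "(L has_derivative L) (at x)" for x
    using assms(2) by (rule bounded_linear_imp_has_derivative)
  have "Ck_on k S L" for k
  proof (cases k)
    case 0
    then show ?thesis
      using assms(2) linear_continuous_on by auto
  next
    case (Suc k)
    have "Ck_on k S (\<lambda>x. frechet_derivative L (at x) v)" for v
      using Ck_on_const[of k S "L v"] by (simp flip: frechet_derivative_at[OF L])
    then show ?thesis
      using L Suc by (auto simp: differentiable_def)
  qed
  then show ?thesis by (simp add: smooth_on_def)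
qed

lemma frechet_derivative_add:
  assumes "f differentiable (at x)" "g differentiable (at x)"
  shows "frechet_derivative (\<lambda>y. f y + g y) (at x) v =
    frechet_derivative f (at x) v + frechet_derivative g (at x) v"
proof -
  have "((\<lambda>y. f y + g y) has_derivative
      (\<lambda>v. frechet_derivative f (at x) v + frechet_derivative g (at x) v)) (at x)"
    using assms has_derivative_add frechet_derivative_works by blast
  from frechet_derivative_at[OF this, symmetric] show ?thesis by simp
qed

lemma Ck_on_add:
  assumes "open S" "Ck_on k S f" "Ck_on k S g"
  shows "Ck_on k S (\<lambda>x. f x + g x)"
  using assms(2,3)
proof (induction k arbitrary: f g)
  case 0
  then show ?case by (simp add: continuous_on_add)
next
  case (Suc k)
  have d: "f differentiable (at x)" "g differentiable (at x)" if "x \<in> S" for x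
    using Suc.prems that by simp_all
  have "Ck_on k S (\<lambda>x. frechet_derivative (\<lambda>y. f y + g y) (at x) v)" for v
  proof (rule Ck_on_cong[OF assms(1)])
    show "Ck_on k S (\<lambda>x. frechet_derivative f (at x) v + frechet_derivative g (at x) v)"
      using Suc by simp
    show "frechet_derivative f (at x) v + frechet_derivative g (at x) v =
        frechet_derivative (\<lambda>y. f y + g y) (at x) v" if "x \<in> S" for x
      using frechet_derivative_add[OF d[OF that]] by simp
  qed
  with d show ?case by simp
qed

lemma smooth_on_add:
  "open S \<Longrightarrow> smooth_on S f \<Longrightarrow> smooth_on S g \<Longrightarrow> smooth_on S (\<lambda>x. f x + g x)"
  by (simp add: smooth_on_def Ck_on_add)

lemma frechet_derivative_times:
  fixes f g :: "'a::real_normed_vector \<Rightarrow> 'b::real_normed_algebra"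
  assumes "f differentiable (at x)" "g differentiable (at x)"
  shows "frechet_derivative (\<lambda>y. f y * g y) (at x) v =
    f x * frechet_derivative g (at x) v + frechet_derivative f (at x) v * g x"
proof -
  have "((\<lambda>y. f y * g y) has_derivative
      (\<lambda>v. f x * frechet_derivative g (at x) v + frechet_derivative f (at x) v * g x)) (at x)"
    using assms has_derivative_mult frechet_derivative_works by blast
  from frechet_derivative_at[OF this, symmetric] show ?thesis by simp
qed

lemma Ck_on_mult:
  fixes f g :: "'a::real_normed_vector \<Rightarrow> 'b::real_normed_algebra"
  assumes "open S" "Ck_on k S f" "Ck_on k S g"
  shows "Ck_on k S (\<lambda>x. f x * g x)"
  using assms(2,3)
proof (induction k arbitrary: f g)
  case 0
  then show ?case by (simp add: continuous_on_mult)
next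
  case (Suc k)
  have d: "f differentiable (at x)" "g differentiable (at x)" if "x \<in> S" for x
    using Suc.prems that by simp_all
  have "Ck_on k S (\<lambda>x. frechet_derivative (\<lambda>y. f y * g y) (at x) v)" for v
  proof (rule Ck_on_cong[OF assms(1)])
    \<comment> \<open>The Leibniz rule also contains the undifferentiated factors, so they are
      needed at level \<open>k\<close> as well; \<open>Ck_on_SucD\<close> supplies this.\<close>
    show "Ck_on k S (\<lambda>x. f x * frechet_derivative g (at x) v + frechet_derivative f (at x) v * g x)"
      using Suc.prems Ck_on_SucD[OF Suc.prems(1)] Ck_on_SucD[OF Suc.prems(2)]
      by (intro Ck_on_add assms(1) Suc.IH) simp_all
    show "f x * frechet_derivative g (at x) v + frechet_derivative f (at x) v * g x =
        frechet_derivative (\<lambda>y. f y * g y) (at x) v" if "x \<in> S" for x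
      using frechet_derivative_times[OF d[OF that]] by simp
  qed
  with d show ?case by (simp add: differentiable_mult)
qed

lemma smooth_on_mult:
  fixes f g :: "'a::real_normed_vector \<Rightarrow> 'b::real_normed_algebra"
  shows "open S \<Longrightarrow> smooth_on S f \<Longrightarrow> smooth_on S g \<Longrightarrow> smooth_on S (\<lambda>x. f x * g x)"
  by (simp add: smooth_on_def Ck_on_mult)

lemma smooth_on_minus: "open S \<Longrightarrow> smooth_on S f \<Longrightarrow> smooth_on S (\<lambda>x. - f x)"
  by (rule smooth_on_linear_comp) (auto intro: bounded_linear_minus bounded_linear_ident)

lemma smooth_on_diff:
  "open S \<Longrightarrow> smooth_on S f \<Longrightarrow> smooth_on S g \<Longrightarrow> smooth_on S (\<lambda>x. f x - g x)"
  using smooth_on_add[of S f "\<lambda>x. - g x"] smooth_on_minus[of S g] by simp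

lemma Ck_on_inverse:
  fixes f :: "'a::real_normed_vector \<Rightarrow> 'b::real_normed_div_algebra"
  assumes "open S" "\<And>x. x \<in> S \<Longrightarrow> f x \<noteq> 0" "Ck_on k S f"
  shows "Ck_on k S (\<lambda>x. inverse (f x))"
  using assms(3)
proof (induction k)
  case 0
  then show ?case using assms(2) by (simp add: continuous_on_inverse)
next
  case (Suc k)
  have h: "((\<lambda>y. inverse (f y)) has_derivative
      (\<lambda>v. - (inverse (f x) * frechet_derivative f (at x) v * inverse (f x)))) (at x)"
    if "x \<in> S" for x
    using Suc.prems that Deriv.has_derivative_inverse[where f = f and x = x and S = UNIV, OF assms(2)[OF that]]
      frechet_derivative_works[of f "at x"] by simp
  have "Ck_on k S (\<lambda>x. frechet_derivative (\<lambda>y. inverse (f y)) (at x) v)" for v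
  proof (rule Ck_on_cong[OF assms(1)])
    \<comment> \<open>The induction hypothesis makes the inverse itself C^k, and its derivative is a
      product of such functions.\<close>
    have "Ck_on k S (\<lambda>x. inverse (f x) * frechet_derivative f (at x) v * inverse (f x))"
      using Suc.prems Suc.IH[OF Ck_on_SucD[OF Suc.prems]]
      by (intro Ck_on_mult assms(1)) simp_all
    from Ck_on_linear_comp[OF assms(1) bounded_linear_minus[OF bounded_linear_ident] this]
    show "Ck_on k S (\<lambda>x. - (inverse (f x) * frechet_derivative f (at x) v * inverse (f x)))" .
    show "- (inverse (f x) * frechet_derivative f (at x) v * inverse (f x)) =
        frechet_derivative (\<lambda>y. inverse (f y)) (at x) v" if "x \<in> S" for x
      using frechet_derivative_at[OF h[OF that], symmetric] by simp
  qed
  moreover have "(\<lambda>y. inverse (f y)) differentiable (at x)" if "x \<in> S" for x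
    using h[OF that] differentiable_def by blast
  ultimately show ?case by simp
qed

lemma smooth_on_divide:
  fixes f g :: "'a::real_normed_vector \<Rightarrow> 'b::real_normed_field"
  assumes "open S" "smooth_on S f" "smooth_on S g" "\<And>x. x \<in> S \<Longrightarrow> g x \<noteq> 0"
  shows "smooth_on S (\<lambda>x. f x / g x)"
proof -
  have "smooth_on S (\<lambda>x. inverse (g x))"
    using assms by (simp add: smooth_on_def Ck_on_inverse)
  from smooth_on_mult[OF assms(1,2) this] show ?thesis
    by (simp add: divide_inverse)
qed

lemma smooth_on_sum:
  "open S \<Longrightarrow> (\<And>i. i \<in> I \<Longrightarrow> smooth_on S (f i)) \<Longrightarrow> smooth_on S (\<lambda>x. \<Sum>i\<in>I. f i x)"
  by (induction I rule: infinite_finite_induct) (auto intro!: smooth_on_add smooth_on_const)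

text \<open>The second difference of \<open>f\<close> over a small parallelogram is, by two applications of the mean
  value theorem in either order, \<open>h\<^sup>2\<close> times either mixed derivative at a nearby point.\<close>

lemma second_difference_mvt:
  fixes f :: "'a::real_normed_vector \<Rightarrow> real"
  assumes h: "0 < h" and sub: "\<And>s t. 0 \<le> s \<Longrightarrow> s \<le> h \<Longrightarrow> 0 \<le> t \<Longrightarrow> t \<le> h \<Longrightarrow> x + s *\<^sub>R u + t *\<^sub>R v \<in> S"
    and f: "\<And>y. y \<in> S \<Longrightarrow> f differentiable (at y)"
    and fu: "\<And>y. y \<in> S \<Longrightarrow> (\<lambda>y. frechet_derivative f (at y) u) differentiable (at y)"
  obtains s t where "0 < s" "s < h" "0 < t" "t < h"
    "f (x + h *\<^sub>R u + h *\<^sub>R v) - f (x + h *\<^sub>R u) - f (x + h *\<^sub>R v) + f x =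
      h * h * frechet_derivative (\<lambda>y. frechet_derivative f (at y) u) (at (x + s *\<^sub>R u + t *\<^sub>R v)) v"
proof -
  have line: "((\<lambda>s. k (a + s *\<^sub>R w)) has_real_derivative frechet_derivative k (at (a + s *\<^sub>R w)) w) (at s)"
    if "k differentiable (at (a + s *\<^sub>R w))" for k :: "'a \<Rightarrow> real" and a w s
  proof -
    have "((\<lambda>s. a + s *\<^sub>R w) has_derivative (\<lambda>s. s *\<^sub>R w)) (at s)"
      by (auto intro!: derivative_eq_intros)
    from diff_chain_at[OF this, of k] that frechet_derivative_works
    have "((\<lambda>s. k (a + s *\<^sub>R w)) has_derivative
        (\<lambda>s'. frechet_derivative k (at (a + s *\<^sub>R w)) (s' *\<^sub>R w))) (at s)"
      by (fastforce simp: o_def)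
    then show ?thesis
      using linear_frechet_derivative[OF that]
      by (simp add: has_field_derivative_def linear_cmul mult_commute_abs)
  qed
  \<comment> \<open>The increment of \<open>f\<close> by \<open>h\<close> in direction
    \<open>v\<close>, as a function of the position along \<open>u\<close>; its change over the
    interval from 0 to \<open>h\<close> is the second difference.\<close>
  define \<phi> where "\<phi> = (\<lambda>s. f (x + h *\<^sub>R v + s *\<^sub>R u) - f (x + s *\<^sub>R u))"
  have "\<exists>s. 0 < s \<and> s < h \<and> \<phi> h - \<phi> 0 = (h - 0) *
      (frechet_derivative f (at (x + h *\<^sub>R v + s *\<^sub>R u)) u - frechet_derivative f (at (x + s *\<^sub>R u)) u)"
  proof (rule MVT2[OF h])
    fix s assume s: "0 \<le> s" "s \<le> h"
    have "x + h *\<^sub>R v + s *\<^sub>R u \<in> S" "x + s *\<^sub>R u \<in> S"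
      using sub[OF s, of h] sub[OF s, of 0] h by (simp_all add: algebra_simps)
    then show "(\<phi> has_real_derivative (frechet_derivative f (at (x + h *\<^sub>R v + s *\<^sub>R u)) u -
        frechet_derivative f (at (x + s *\<^sub>R u)) u)) (at s)"
      unfolding \<phi>_def by (intro DERIV_diff line f)
  qed
  then obtain s where s: "0 < s" "s < h" and es: "\<phi> h - \<phi> 0 = h *
      (frechet_derivative f (at (x + h *\<^sub>R v + s *\<^sub>R u)) u - frechet_derivative f (at (x + s *\<^sub>R u)) u)"
    by auto
  have "\<exists>t. 0 < t \<and> t < h \<and>
      frechet_derivative f (at (x + s *\<^sub>R u + h *\<^sub>R v)) u - frechet_derivative f (at (x + s *\<^sub>R u + 0 *\<^sub>R v)) u =
      (h - 0) * frechet_derivative (\<lambda>y. frechet_derivative f (at y) u) (at (x + s *\<^sub>R u + t *\<^sub>R v)) v"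
    using s by (intro MVT2[OF h] line fu sub) auto
  then obtain t where "0 < t" "t < h" and
    "frechet_derivative f (at (x + s *\<^sub>R u + h *\<^sub>R v)) u - frechet_derivative f (at (x + s *\<^sub>R u)) u =
      h * frechet_derivative (\<lambda>y. frechet_derivative f (at y) u) (at (x + s *\<^sub>R u + t *\<^sub>R v)) v"
    by auto
  with s es that show ?thesis
    by (simp add: \<phi>_def algebra_simps)
qed

text \<open>If the two mixed derivatives differed at \<open>x\<close>, continuity would keep each
  within half of the gap on a small ball. The second difference forces them to agree at two points
  of that ball.\<close>

lemma frechet_derivative_commute_real:
  fixes f :: "'a::real_normed_vector \<Rightarrow> real"
  assumes S: "open S" "x \<in> S" and f: "smooth_on S f"
  shows "frechet_derivative (\<lambda>y. frechet_derivative f (at y) u) (at x) v =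
    frechet_derivative (\<lambda>y. frechet_derivative f (at y) v) (at x) u" (is "?P x = ?Q x")
proof (rule ccontr)
  assume "?P x \<noteq> ?Q x"
  then have e: "\<bar>?P x - ?Q x\<bar> / 2 > 0" (is "?e > 0") by simp
  have "continuous_on S ?P" "continuous_on S ?Q"
    using f by (auto intro!: smooth_on_imp_continuous smooth_on_frechet)
  then have "continuous (at x) ?P" "continuous (at x) ?Q"
    using S continuous_on_eq_continuous_at by blast+
  then have "\<exists>d>0. \<forall>y. dist y x < d \<longrightarrow> dist (?P y) (?P x) < ?e"
    "\<exists>d>0. \<forall>y. dist y x < d \<longrightarrow> dist (?Q y) (?Q x) < ?e"
    using e unfolding continuous_at_eps_delta by blast+
  then obtain d1 d2 where d1: "d1 > 0" "\<And>y. dist y x < d1 \<Longrightarrow> dist (?P y) (?P x) < ?e"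
    and d2: "d2 > 0" "\<And>y. dist y x < d2 \<Longrightarrow> dist (?Q y) (?Q x) < ?e"
    by auto
  from S obtain d3 where d3: "d3 > 0" "ball x d3 \<subseteq> S"
    using open_contains_ball by blast
  define d where "d = Min {d1, d2, d3}"
  \<comment> \<open>Chosen so that \<open>h * K\<close> is half of \<open>d\<close>, which keeps the
    parallelogram inside the ball; the summand 1 makes \<open>K\<close> positive even for
    \<open>u = v = 0\<close>.\<close>
  define K where "K = norm u + norm v + 1"
  define h where "h = d / (2 * K)"
  have d: "0 < d" "d \<le> d1" "d \<le> d2" "d \<le> d3"
    using d1 d2 d3 by (auto simp: d_def)
  have n: "K > 0"
    by (simp add: K_def add_nonneg_pos)
  then have h: "0 < h" using d by (simp add: h_def)
  have near: "dist (x + s *\<^sub>R u + t *\<^sub>R v) x < d" if "0 \<le> s" "s \<le> h" "0 \<le> t" "t \<le> h" for s t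
  proof -
    have "dist (x + s *\<^sub>R u + t *\<^sub>R v) x = norm (s *\<^sub>R u + t *\<^sub>R v)"
      by (simp add: dist_norm algebra_simps)
    also have "\<dots> \<le> s * norm u + t * norm v"
      using that norm_triangle_ineq[of "s *\<^sub>R u" "t *\<^sub>R v"] by simp
    also have "\<dots> \<le> h * norm u + h * norm v"
      using that by (intro add_mono mult_right_mono) auto
    also have "\<dots> \<le> h * K"
      using h by (simp add: K_def algebra_simps)
    also have "\<dots> = d / 2" using n by (simp add: h_def)
    finally show ?thesis using d by simp
  qed
  have sub: "x + s *\<^sub>R u + t *\<^sub>R v \<in> S" if "0 \<le> s" "s \<le> h" "0 \<le> t" "t \<le> h" for s t
    using near[OF that] d d3 by (auto simp: dist_commute subset_iff)
  then have sub': "x + t *\<^sub>R v + s *\<^sub>R u \<in> S" if "0 \<le> t" "t \<le> h" "0 \<le> s" "s \<le> h" for s t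
    using that by (simp add: algebra_simps)
  note fd = smooth_on_imp_differentiable[OF f]
    and fd' = smooth_on_imp_differentiable[OF smooth_on_frechet[OF f]]
  obtain s t where st: "0 < s" "s < h" "0 < t" "t < h"
    and 1: "f (x + h *\<^sub>R u + h *\<^sub>R v) - f (x + h *\<^sub>R u) - f (x + h *\<^sub>R v) + f x =
      h * h * ?P (x + s *\<^sub>R u + t *\<^sub>R v)"
    by (rule second_difference_mvt[OF h sub fd fd'])
  obtain t' s' where st': "0 < t'" "t' < h" "0 < s'" "s' < h"
    and 2: "f (x + h *\<^sub>R v + h *\<^sub>R u) - f (x + h *\<^sub>R v) - f (x + h *\<^sub>R u) + f x =
      h * h * ?Q (x + t' *\<^sub>R v + s' *\<^sub>R u)"
    by (rule second_difference_mvt[OF h sub' fd fd'])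
  have "h * h * ?P (x + s *\<^sub>R u + t *\<^sub>R v) = h * h * ?Q (x + s' *\<^sub>R u + t' *\<^sub>R v)"
  proof -
    have e: "x + h *\<^sub>R v + h *\<^sub>R u = x + h *\<^sub>R u + h *\<^sub>R v"
      "x + t' *\<^sub>R v + s' *\<^sub>R u = x + s' *\<^sub>R u + t' *\<^sub>R v"
      by (simp_all add: algebra_simps)
    from 1 2[unfolded e] show ?thesis by linarith
  qed
  then have "?P (x + s *\<^sub>R u + t *\<^sub>R v) = ?Q (x + s' *\<^sub>R u + t' *\<^sub>R v)"
    using h by simp
  moreover have "dist (?P (x + s *\<^sub>R u + t *\<^sub>R v)) (?P x) < ?e"
    using near[of s t] st d by (intro d1(2)) auto
  moreover have "dist (?Q (x + s' *\<^sub>R u + t' *\<^sub>R v)) (?Q x) < ?e"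
    using near[of s' t'] st' d by (intro d2(2)) auto
  ultimately show False
    unfolding dist_real_def by (auto simp: abs_if split: if_splits)
qed

text \<open>The mean value theorem is a real statement, so it is applied to the real and the
  imaginary part separately.\<close>

lemma frechet_derivative_commute:
  fixes f :: "'a::real_normed_vector \<Rightarrow> complex"
  assumes S: "open S" "x \<in> S" and f: "smooth_on S f"
  shows "frechet_derivative (\<lambda>y. frechet_derivative f (at y) u) (at x) v =
    frechet_derivative (\<lambda>y. frechet_derivative f (at y) v) (at x) u"
proof -
  have *: "L (frechet_derivative (\<lambda>y. frechet_derivative f (at y) u) (at x) v) =
      frechet_derivative (\<lambda>y. frechet_derivative (\<lambda>z. L (f z)) (at y) u) (at x) v"
    if L: "bounded_linear L" for L :: "complex \<Rightarrow> real" and u v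
  proof -
    have "L (frechet_derivative (\<lambda>y. frechet_derivative f (at y) u) (at x) v) =
        frechet_derivative (\<lambda>y. L (frechet_derivative f (at y) u)) (at x) v"
      using frechet_derivative_linear_comp[OF L] smooth_on_imp_differentiable[OF smooth_on_frechet[OF f] S(2)]
      by metis
    also have "\<dots> = frechet_derivative (\<lambda>y. frechet_derivative (\<lambda>z. L (f z)) (at y) u) (at x) v"
      using frechet_derivative_cong_open[OF S, of "\<lambda>y. L (frechet_derivative f (at y) u)"]
        frechet_derivative_linear_comp[OF L smooth_on_imp_differentiable[OF f]] by metis
    finally show ?thesis .
  qed
  have "L (frechet_derivative (\<lambda>y. frechet_derivative f (at y) u) (at x) v) =
    L (frechet_derivative (\<lambda>y. frechet_derivative f (at y) v) (at x) u)"
    if L: "bounded_linear L" for L :: "complex \<Rightarrow> real"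
    unfolding *[OF L]
    by (rule frechet_derivative_commute_real[OF S smooth_on_linear_comp[OF S(1) L f]])
  from this[OF bounded_linear_Re] this[OF bounded_linear_Im] show ?thesis
    by (rule complex_eqI)
qed



section \<open>Derivations at a point\<close>

text \<open>Common abstraction of all differential operators of the proof, evaluated at one point.
  The last clause is locality: an identity that holds only on an open set may be differentiated
  there.\<close>

definition derivation_at :: "'x::real_normed_vector \<Rightarrow> (('x \<Rightarrow> complex) \<Rightarrow> complex) \<Rightarrow> bool" where
  "derivation_at x D \<longleftrightarrow>
     (\<forall>u v. u differentiable (at x) \<longrightarrow> v differentiable (at x) \<longrightarrow>
        D (\<lambda>y. u y + v y) = D u + D v \<and> D (\<lambda>y. u y * v y) = D u * v x + u x * D v) \<and>
     (\<forall>c. D (\<lambda>y. c) = 0) \<and>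
     (\<forall>u v S. open S \<longrightarrow> x \<in> S \<longrightarrow> (\<forall>y\<in>S. u y = v y) \<longrightarrow> D u = D v)"

lemma derivation_atI:
  assumes "\<And>u v. u differentiable (at x) \<Longrightarrow> v differentiable (at x) \<Longrightarrow> D (\<lambda>y. u y + v y) = D u + D v"
    and "\<And>u v. u differentiable (at x) \<Longrightarrow> v differentiable (at x) \<Longrightarrow>
      D (\<lambda>y. u y * v y) = D u * v x + u x * D v"
    and "\<And>c. D (\<lambda>y. c) = 0"
    and "\<And>u v S. open S \<Longrightarrow> x \<in> S \<Longrightarrow> (\<And>y. y \<in> S \<Longrightarrow> u y = v y) \<Longrightarrow> D u = D v"
  shows "derivation_at x D"
  unfolding derivation_at_def using assms by blast

lemma derivation_add:
  "derivation_at x D \<Longrightarrow> u differentiable (at x) \<Longrightarrow> v differentiable (at x) \<Longrightarrow>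
    D (\<lambda>y. u y + v y) = D u + D v"
  and derivation_mult:
  "derivation_at x D \<Longrightarrow> u differentiable (at x) \<Longrightarrow> v differentiable (at x) \<Longrightarrow>
    D (\<lambda>y. u y * v y) = D u * v x + u x * D v"
  and derivation_const: "derivation_at x D \<Longrightarrow> D (\<lambda>y. c) = 0"
  and derivation_cong:
  "derivation_at x D \<Longrightarrow> open S \<Longrightarrow> x \<in> S \<Longrightarrow> (\<And>y. y \<in> S \<Longrightarrow> u y = v y) \<Longrightarrow> D u = D v"
  unfolding derivation_at_def by blast+

lemma derivation_at_frechet: "derivation_at x (\<lambda>u. frechet_derivative u (at x) v)"
proof (rule derivation_atI)
  show "frechet_derivative u (at x) v = frechet_derivative u' (at x) v"
    if "open S" "x \<in> S" "\<And>y. y \<in> S \<Longrightarrow> u y = u' y" for u u' :: "'a \<Rightarrow> complex" and S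
    using frechet_derivative_cong_open[OF that(1,2), of u u'] that(3) by simp
qed (simp_all add: frechet_derivative_add frechet_derivative_times frechet_derivative_const)

text \<open>The coefficients are numbers. At a fixed point the values of N^j_k, eta^k or m^s are
  numbers too, and this makes \<open>delta_h\<close>, \<open>deriv_0\<close> and
  \<open>deriv_m\<close> derivations.\<close>

lemma derivation_at_lincomb:
  assumes D: "derivation_at x D" and E: "derivation_at x E"
  shows "derivation_at x (\<lambda>u. a * D u + b * E u)"
proof (rule derivation_atI)
  show "a * D u + b * E u = a * D v + b * E v"
    if "open S" "x \<in> S" "\<And>y. y \<in> S \<Longrightarrow> u y = v y" for u v S
    using derivation_cong[OF D that] derivation_cong[OF E that] by simp
qed (simp_all add: derivation_add[OF D] derivation_add[OF E] derivation_mult[OF D] derivation_mult[OF E]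
    derivation_const[OF D] derivation_const[OF E] algebra_simps)

lemma derivation_at_add: "derivation_at x D \<Longrightarrow> derivation_at x E \<Longrightarrow> derivation_at x (\<lambda>u. D u + E u)"
  using derivation_at_lincomb[of x D E 1 1] by simp

lemma derivation_at_cmult: "derivation_at x D \<Longrightarrow> derivation_at x (\<lambda>u. a * D u)"
  using derivation_at_lincomb[of x D D a 0] by simp

lemma derivation_at_diff: "derivation_at x D \<Longrightarrow> derivation_at x E \<Longrightarrow> derivation_at x (\<lambda>u. D u - E u)"
  using derivation_at_lincomb[of x D E 1 "-1"] by simp

lemma derivation_at_sum:
  "finite I \<Longrightarrow> (\<And>i. i \<in> I \<Longrightarrow> derivation_at x (D i)) \<Longrightarrow> derivation_at x (\<lambda>u. \<Sum>i\<in>I. D i u)"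
  by (induction I rule: finite_induct)
    (auto simp: derivation_at_add, auto simp: derivation_at_def)

context
  fixes x :: "'x::real_normed_vector" and D
  assumes D: "derivation_at x D"
begin

lemma derivation_cmult: "u differentiable (at x) \<Longrightarrow> D (\<lambda>y. c * u y) = c * D u"
  using derivation_mult[OF D, of "\<lambda>y. c" u] by (simp add: derivation_const[OF D])

lemma derivation_minus: "u differentiable (at x) \<Longrightarrow> D (\<lambda>y. - u y) = - D u"
  using derivation_cmult[of u "-1"] by simp

lemma derivation_diff:
  assumes "u differentiable (at x)" "v differentiable (at x)"
  shows "D (\<lambda>y. u y - v y) = D u - D v"
  using derivation_add[OF D, of u "\<lambda>y. - v y"] assms by (simp add: derivation_minus)

lemma derivation_sum:
  "(\<And>i. i \<in> I \<Longrightarrow> u i differentiable (at x)) \<Longrightarrow> D (\<lambda>y. \<Sum>i\<in>I. u i y) = (\<Sum>i\<in>I. D (u i))"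
proof (induction I rule: infinite_finite_induct)
  case (insert i I)
  then have "(\<lambda>y. \<Sum>i\<in>I. u i y) differentiable (at x)"
    by (intro differentiable_sum) auto
  with insert show ?case by (simp add: derivation_add[OF D])
qed (simp_all add: derivation_const[OF D])

text \<open>Obtained from the Leibniz rule for \<open>(u / v) * v\<close>, which equals
  \<open>u\<close> near \<open>x\<close> because \<open>v\<close> has no zero there.\<close>

lemma derivation_divide:
  assumes u: "u differentiable (at x)" and v: "v differentiable (at x)" "v x \<noteq> 0"
  shows "D (\<lambda>y. u y / v y) = (D u * v x - u x * D v) / (v x)\<^sup>2"
proof -
  have d: "(\<lambda>y. u y / v y) differentiable (at x)"
    using assms by (intro differentiable_divide)
  obtain e where e: "e > 0" "\<And>y. dist x y < e \<Longrightarrow> v y \<noteq> 0"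
    using continuous_at_avoid[OF differentiable_imp_continuous_within[OF v(1)] v(2)] by blast
  have "D u = D (\<lambda>y. (u y / v y) * v y)"
    by (rule derivation_cong[OF D, of "ball x e"]) (use e in auto)
  also have "\<dots> = D (\<lambda>y. u y / v y) * v x + (u x / v x) * D v"
    by (rule derivation_mult[OF D d v(1)])
  finally show ?thesis
    using v(2) by (simp add: field_simps power2_eq_square)
qed

end


lemma differentiable_csqrt:
  assumes "u differentiable (at w)" "u w \<notin> \<real>\<^sub>\<le>\<^sub>0"
  shows "(\<lambda>y. csqrt (u y)) differentiable (at w)"
proof -
  have "(csqrt has_derivative (*) (inverse (2 * csqrt (u w)))) (at (u w))"
    using has_field_derivative_csqrt[OF assms(2)] by (simp add: has_field_derivative_def)
  then show ?thesis
    using assms(1) diff_chain_at[of u _ w csqrt] unfolding differentiable_def o_def by blast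
qed

text \<open>Works for any differentiable square root, with no branch in sight; it serves both F as a
  root of F^2 and sqrt g as a root of g.\<close>

lemma derivation_sqrt:
  assumes D: "derivation_at w D" and S: "open S" "w \<in> S" "\<And>y. y \<in> S \<Longrightarrow> r y * r y = u y"
    and r: "r differentiable (at w)" "r w \<noteq> 0"
  shows "D r = D u / (2 * r w)"
proof -
  have "D u = D (\<lambda>y. r y * r y)"
    by (rule derivation_cong[OF D S(1,2)]) (simp add: S(3))
  also have "\<dots> = D r * r w + r w * D r"
    by (rule derivation_mult[OF D r(1) r(1)])
  finally show ?thesis using r(2) by simp
qed



section \<open>Wirtinger derivatives\<close>

text \<open>With \<open>a\<close>, \<open>b\<close> the real and imaginary direction of a
  coordinate, \<open>c = - \<i>\<close> gives the derivative by the coordinate and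
  \<open>c = \<i>\<close> the one by its conjugate. Smoothness and commutation then need one proof
  for all three families.\<close>

definition wirtinger :: "'x::real_normed_vector \<Rightarrow> 'x \<Rightarrow> complex \<Rightarrow> ('x \<Rightarrow> complex) \<Rightarrow> 'x \<Rightarrow> complex" where
  "wirtinger a b c f x = (frechet_derivative f (at x) a + c * frechet_derivative f (at x) b) / 2"

lemma d_z_wirtinger: "d_z k = wirtinger (axis k 1, 0) (axis k \<i>, 0) (- \<i>)"
  and d_eta_wirtinger: "d_eta k = wirtinger (0, axis k 1) (0, axis k \<i>) (- \<i>)"
  and d_etabar_wirtinger: "d_etabar k = wirtinger (0, axis k 1) (0, axis k \<i>) \<i>"
  by (auto simp: fun_eq_iff wirtinger_def d_z_def d_eta_def d_etabar_def)

lemma derivation_at_wirtinger: "derivation_at x (\<lambda>f. wirtinger a b c f x)"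
  using derivation_at_cmult[OF derivation_at_lincomb[OF derivation_at_frechet derivation_at_frechet],
      of x "1/2" 1 a c b]
  by (simp add: wirtinger_def)

lemma smooth_on_wirtinger:
  assumes "open S" "smooth_on S f"
  shows "smooth_on S (wirtinger a b c f)"
proof -
  have "smooth_on S (\<lambda>x. (frechet_derivative f (at x) a + c * frechet_derivative f (at x) b) / 2)"
    using assms by (intro smooth_on_divide smooth_on_add smooth_on_mult smooth_on_const smooth_on_frechet) auto
  moreover have "wirtinger a b c f = (\<lambda>x. (frechet_derivative f (at x) a + c * frechet_derivative f (at x) b) / 2)"
    by (simp add: fun_eq_iff wirtinger_def)
  ultimately show ?thesis by simp
qed

lemma wirtinger_commute:
  assumes "open S" "x \<in> S" "smooth_on S f"
  shows "wirtinger a b c (wirtinger a' b' c' f) x = wirtinger a' b' c' (wirtinger a b c f) x"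
proof -
  have *: "frechet_derivative (wirtinger a b c f) (at x) v =
     (frechet_derivative (\<lambda>y. frechet_derivative f (at y) a) (at x) v +
       c * frechet_derivative (\<lambda>y. frechet_derivative f (at y) b) (at x) v) / 2" for a b c v
  proof -
    note D = derivation_at_frechet[of x v]
    have d: "(\<lambda>y. frechet_derivative f (at y) u) differentiable (at x)" for u
      using smooth_on_imp_differentiable[OF smooth_on_frechet[OF assms(3)] assms(2)] .
    have e: "wirtinger a b c f = (\<lambda>y. (1/2) * (frechet_derivative f (at y) a + c * frechet_derivative f (at y) b))"
      by (simp add: fun_eq_iff wirtinger_def)
    show ?thesis
      unfolding e by (simp only: derivation_cmult[OF D] derivation_add[OF D] d differentiable_add
          differentiable_mult differentiable_const) simp
  qed
  show ?thesis
    unfolding wirtinger_def[of _ _ _ "wirtinger _ _ _ _"] *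
    using frechet_derivative_commute[OF assms] by (simp add: algebra_simps add_divide_distrib)
qed

lemma derivation_at_d_z: "derivation_at w (\<lambda>u. d_z k u w)"
  and derivation_at_d_eta: "derivation_at w (\<lambda>u. d_eta k u w)"
  and derivation_at_d_etabar: "derivation_at w (\<lambda>u. d_etabar k u w)"
  unfolding d_z_wirtinger d_eta_wirtinger d_etabar_wirtinger by (rule derivation_at_wirtinger)+

lemma derivation_at_delta_h: "derivation_at w (\<lambda>u. delta_h f k u w)"
  unfolding delta_h_def
  by (intro derivation_at_diff derivation_at_sum derivation_at_cmult derivation_at_d_z
      derivation_at_d_eta) simp

lemma derivation_at_deriv_0: "derivation_at w (\<lambda>u. deriv_0 u w)"
  unfolding deriv_0_def
  by (intro derivation_at_sum derivation_at_cmult derivation_at_d_eta) simp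

lemma derivation_at_deriv_m: "derivation_at w (\<lambda>u. deriv_m f u w)"
  unfolding deriv_m_def
  by (intro derivation_at_sum derivation_at_cmult derivation_at_d_eta) simp

lemma smooth_on_d_z: "open S \<Longrightarrow> smooth_on S f \<Longrightarrow> smooth_on S (d_z k f)"
  and smooth_on_d_eta: "open S \<Longrightarrow> smooth_on S f \<Longrightarrow> smooth_on S (d_eta k f)"
  and smooth_on_d_etabar: "open S \<Longrightarrow> smooth_on S f \<Longrightarrow> smooth_on S (d_etabar k f)"
  unfolding d_z_wirtinger d_eta_wirtinger d_etabar_wirtinger by (rule smooth_on_wirtinger; assumption)+

lemma d_eta_d_eta_commute:
  "open S \<Longrightarrow> w \<in> S \<Longrightarrow> smooth_on S f \<Longrightarrow> d_eta j (d_eta k f) w = d_eta k (d_eta j f) w"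
  and d_eta_d_z_commute:
  "open S \<Longrightarrow> w \<in> S \<Longrightarrow> smooth_on S f \<Longrightarrow> d_eta j (d_z k f) w = d_z k (d_eta j f) w"
  and d_eta_d_etabar_commute:
  "open S \<Longrightarrow> w \<in> S \<Longrightarrow> smooth_on S f \<Longrightarrow> d_eta j (d_etabar k f) w = d_etabar k (d_eta j f) w"
  unfolding d_z_wirtinger d_eta_wirtinger d_etabar_wirtinger by (rule wirtinger_commute; assumption)+

lemma bounded_linear_fibre_coord: "bounded_linear (\<lambda>w. snd w $ i)"
  by (intro bounded_linear_compose[OF bounded_linear_vec_nth bounded_linear_snd])

lemma bounded_linear_cnj_fibre_coord: "bounded_linear (\<lambda>w. cnj (snd w $ i))"
  by (rule bounded_linear_compose[OF bounded_linear_cnj bounded_linear_fibre_coord])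

lemma d_eta_fibre_coord: "d_eta k (\<lambda>w. snd w $ i) w = (if i = k then 1 else 0)"
  and d_z_fibre_coord: "d_z k (\<lambda>w. snd w $ i) w = 0"
  and d_etabar_fibre_coord: "d_etabar k (\<lambda>w. snd w $ i) w = 0"
  by (simp_all add: d_eta_def d_z_def d_etabar_def axis_def
      flip: frechet_derivative_at[OF bounded_linear_imp_has_derivative[OF bounded_linear_fibre_coord]])

lemma d_eta_cnj_fibre_coord: "d_eta k (\<lambda>w. cnj (snd w $ i)) w = 0"
  and d_z_cnj_fibre_coord: "d_z k (\<lambda>w. cnj (snd w $ i)) w = 0"
  by (simp_all add: d_eta_def d_z_def axis_def
      flip: frechet_derivative_at[OF bounded_linear_imp_has_derivative[OF bounded_linear_cnj_fibre_coord]])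

lemma d_etabar_cnj:
  assumes "u differentiable (at w)"
  shows "d_etabar k (\<lambda>y. cnj (u y)) w = cnj (d_eta k u w)"
  by (simp add: d_etabar_def d_eta_def frechet_derivative_linear_comp[OF bounded_linear_cnj assms])

text \<open>A Frechet derivative is only real linear, so the expansion runs over the real basis
  consisting of the coordinate vectors and their multiples by the imaginary unit.\<close>

lemma linear_fibre_expand:
  fixes D :: "'a::real_vector \<times> (complex^'n) \<Rightarrow> complex"
  assumes lin: "linear D"
  shows "D (0, v) = (\<Sum>k\<in>UNIV. Re (v $ k) * D (0, axis k 1) + Im (v $ k) * D (0, axis k \<i>))"
proof -
  have "v = (\<Sum>k\<in>UNIV. Re (v $ k) *\<^sub>R axis k 1 + Im (v $ k) *\<^sub>R axis k \<i>)"
    by (simp add: vec_eq_iff axis_def complex_eq_iff if_distrib sum.delta cong: if_cong)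
  then have "(0, v) = (\<Sum>k\<in>UNIV. Re (v $ k) *\<^sub>R (0::'a, axis k 1) + Im (v $ k) *\<^sub>R (0, axis k \<i>))"
    by (simp add: prod_eq_iff fst_sum snd_sum)
  from arg_cong[OF this, of D] show ?thesis
    by (simp only: linear_sum[OF lin] linear_add[OF lin] linear_cmul[OF lin] scaleR_conv_of_real)
qed

text \<open>The two Euler operators recover the derivatives along \<open>\<eta>\<close> and \<open>\<i> \<eta>\<close>, that is,
  along the orbit of the complex scaling.\<close>

lemma d_eta_euler:
  assumes "u differentiable (at (z, \<eta>))"
  shows "(\<Sum>k\<in>UNIV. \<eta> $ k * d_eta k u (z, \<eta>)) =
     (frechet_derivative u (at (z, \<eta>)) (0, \<eta>) - \<i> * frechet_derivative u (at (z, \<eta>)) (0, \<i> *s \<eta>)) / 2"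
    and d_etabar_euler:
    "(\<Sum>k\<in>UNIV. cnj (\<eta> $ k) * d_etabar k u (z, \<eta>)) =
     (frechet_derivative u (at (z, \<eta>)) (0, \<eta>) + \<i> * frechet_derivative u (at (z, \<eta>)) (0, \<i> *s \<eta>)) / 2"
proof -
  let ?D = "frechet_derivative u (at (z, \<eta>))"
  have lin: "linear ?D" using assms by (rule linear_frechet_derivative)
  note exp = linear_fibre_expand[OF lin]
  have split: "\<eta> $ k = Re (\<eta> $ k) + \<i> * Im (\<eta> $ k)" "cnj (\<eta> $ k) = Re (\<eta> $ k) - \<i> * Im (\<eta> $ k)" for k
    by (simp_all add: complex_eq_iff)
  show "(\<Sum>k\<in>UNIV. \<eta> $ k * d_eta k u (z, \<eta>)) = (?D (0, \<eta>) - \<i> * ?D (0, \<i> *s \<eta>)) / 2"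
    unfolding exp[of \<eta>] exp[of "\<i> *s \<eta>"] d_eta_def sum_distrib_left sum_subtractf[symmetric] sum_divide_distrib
    by (intro sum.cong refl) (subst split, simp add: algebra_simps)
  show "(\<Sum>k\<in>UNIV. cnj (\<eta> $ k) * d_etabar k u (z, \<eta>)) = (?D (0, \<eta>) + \<i> * ?D (0, \<i> *s \<eta>)) / 2"
    unfolding exp[of \<eta>] exp[of "\<i> *s \<eta>"] d_etabar_def sum_distrib_left sum.distrib[symmetric] sum_divide_distrib
    by (intro sum.cong refl) (subst split, simp add: algebra_simps)
qed



section \<open>Finsler functions in a coordinate domain\<close>

text \<open>What a complex Finsler space leaves behind in one chart. All identities are local, so
  the manifold returns only at the end, where each chart is shown to satisfy these
  assumptions.\<close>

locale coordinate_finsler =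
  fixes U :: "(complex^2) set" and f :: "(complex^2) \<times> (complex^2) \<Rightarrow> real"
  assumes open_U: "open U"
    and smooth_square: "smooth_on (U \<times> (UNIV - {0})) (\<lambda>w. (f w)\<^sup>2)"
    and pos: "w \<in> U \<times> (UNIV - {0}) \<Longrightarrow> 0 < f w"
    and scaling: "z \<in> U \<Longrightarrow> f (z, a *s \<eta>) = cmod a * f (z, \<eta>)"
    and hermitian: "w \<in> U \<times> (UNIV - {0}) \<Longrightarrow> hermitian_pos_def (fund_matrix f w)"
begin

definition S :: "((complex^2) \<times> (complex^2)) set" where
  "S = U \<times> (UNIV - {0})"

abbreviation \<phi> :: "2 coord_fun" where "\<phi> w \<equiv> complex_of_real (f w)"

definition LL :: "2 coord_fun" where "LL = (\<lambda>w. complex_of_real ((f w)\<^sup>2))"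

abbreviation g :: "2 \<Rightarrow> 2 \<Rightarrow> 2 coord_fun" where "g \<equiv> fund_tensor f"

definition gd :: "2 coord_fun" where "gd = (\<lambda>w. det (fund_matrix f w))"

lemma open_S: "open S"
  unfolding S_def by (intro open_Times open_U open_delete open_UNIV)

lemma LL_square: "LL w = \<phi> w * \<phi> w"
  by (simp add: LL_def power2_eq_square)

lemma \<phi>_nonzero: "w \<in> S \<Longrightarrow> \<phi> w \<noteq> 0"
  using pos[of w] by (simp add: S_def)

lemma g_LL: "g i j = d_eta i (d_etabar j LL)"
  by (simp add: fund_tensor_def LL_def)

lemma gd_eq: "gd = (\<lambda>w. g 1 1 w * g 2 2 w - g 1 2 w * g 2 1 w)"
  by (simp add: gd_def det_2 fund_matrix_def)

lemma smooth_LL: "smooth_on S LL"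
  unfolding LL_def S_def
  by (rule smooth_on_linear_comp[OF open_S[unfolded S_def] bounded_linear_of_real smooth_square])

lemma smooth_g: "smooth_on S (g i j)"
  unfolding g_LL by (intro smooth_on_d_eta smooth_on_d_etabar open_S smooth_LL)

lemma smooth_gd: "smooth_on S gd"
  unfolding gd_eq by (intro smooth_on_diff smooth_on_mult open_S smooth_g)

lemma smooth_fibre_coord: "smooth_on S (\<lambda>w. snd w $ i)"
  by (rule smooth_on_bounded_linear[OF open_S bounded_linear_fibre_coord])

lemma smooth_cnj_fibre_coord: "smooth_on S (\<lambda>w. cnj (snd w $ i))"
  by (rule smooth_on_bounded_linear[OF open_S bounded_linear_cnj_fibre_coord])

lemma smooth_dz: "smooth_on S u \<Longrightarrow> smooth_on S (d_z k u)"
  and smooth_deta: "smooth_on S u \<Longrightarrow> smooth_on S (d_eta k u)"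
  and smooth_detabar: "smooth_on S u \<Longrightarrow> smooth_on S (d_etabar k u)"
  by (intro smooth_on_d_z smooth_on_d_eta smooth_on_d_etabar open_S; assumption)+

lemmas smooth_basic = smooth_LL smooth_g smooth_gd smooth_fibre_coord smooth_cnj_fibre_coord
  smooth_dz smooth_deta smooth_detabar

section \<open>Positivity and inversion of the fundamental matrix\<close>

lemma cnj_g: "w \<in> S \<Longrightarrow> cnj (g i j w) = g j i w"
proof -
  assume "w \<in> S"
  then have "fund_matrix f w $ j $ i = cnj (fund_matrix f w $ i $ j)"
    using hermitian[of w] unfolding S_def hermitian_pos_def_def by blast
  then show ?thesis by (simp add: fund_matrix_def)
qed

lemma g_diag_pos:
  assumes "w \<in> S"
  shows "0 < Re (g 1 1 w)"
proof -
  define v :: "complex^2" where "v = axis 1 1"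
  have "v \<noteq> 0" by (simp add: v_def axis_eq_0_iff)
  then have "0 < Re (\<Sum>i\<in>UNIV. \<Sum>j\<in>UNIV. fund_matrix f w $ i $ j * v $ i * cnj (v $ j))"
    using hermitian[of w] assms unfolding S_def hermitian_pos_def_def by blast
  then show ?thesis
    by (simp add: v_def sum_2 axis_def fund_matrix_def)
qed

text \<open>The test vector \<open>(- g\<^sub>2\<^sub>1, g\<^sub>1\<^sub>1)\<close> turns the Hermitian form into \<open>g\<^sub>1\<^sub>1\<close> times the determinant.\<close>

lemma gd_pos:
  assumes w: "w \<in> S"
  shows "Im (gd w) = 0" "0 < Re (gd w)"
proof -
  note c = cnj_g[OF w]
  have im: "Im (g 1 1 w) = 0" "Im (g 2 2 w) = 0"
    using c[of 1 1] c[of 2 2] by (simp_all add: complex_eq_iff)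
  have re: "Re (g 2 1 w) = Re (g 1 2 w)" "Im (g 2 1 w) = - Im (g 1 2 w)"
    using c[of 1 2] by (simp_all add: complex_eq_iff)
  show "Im (gd w) = 0"
    by (simp add: gd_eq im re)
  define v :: "complex^2" where "v = (\<chi> i. if i = 1 then - g 2 1 w else g 1 1 w)"
  have "v \<noteq> 0"
    using g_diag_pos[OF w] by (auto simp: v_def vec_eq_iff forall_2)
  then have "0 < Re (\<Sum>i\<in>UNIV. \<Sum>j\<in>UNIV. fund_matrix f w $ i $ j * v $ i * cnj (v $ j))"
    using hermitian[of w] w unfolding S_def hermitian_pos_def_def by blast
  also have "(\<Sum>i\<in>UNIV. \<Sum>j\<in>UNIV. fund_matrix f w $ i $ j * v $ i * cnj (v $ j)) = g 1 1 w * gd w"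
    by (simp add: sum_2 fund_matrix_def v_def gd_eq c algebra_simps)
  finally have "0 < Re (g 1 1 w) * Re (gd w)"
    using im by simp
  then show "0 < Re (gd w)"
    using g_diag_pos[OF w] by (simp add: zero_less_mult_iff)
qed

lemma gd_nonzero: "w \<in> S \<Longrightarrow> gd w \<noteq> 0"
  using gd_pos[of w] by auto

lemma
  assumes w: "w \<in> S"
  shows fund_matrix_inv: "fund_matrix f w ** matrix_inv (fund_matrix f w) = mat 1"
    "matrix_inv (fund_matrix f w) ** fund_matrix f w = mat 1"
    and g_inv_eq: "g_inv f 1 1 w = g 2 2 w / gd w" "g_inv f 1 2 w = - g 1 2 w / gd w"
    "g_inv f 2 1 w = - g 2 1 w / gd w" "g_inv f 2 2 w = g 1 1 w / gd w"
proof -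
  let ?G = "fund_matrix f w"
  \<comment> \<open>The adjugate divided by the determinant. Arithmetic in the type \<open>2\<close>
    is modulo 2, so \<open>3 - i\<close> exchanges the two indices.\<close>
  define H :: "complex^2^2" where "H = (\<chi> i j. (if i = j then g (3 - i) (3 - i) w else - g i j w) / gd w)"
  note nz = gd_nonzero[OF w]
  have s: "(3::2) - 1 = 2" "(3::2) - 2 = 1" by simp_all
  have det: "g 1 1 w * g 2 2 w = gd w + g 1 2 w * g 2 1 w" by (simp add: gd_eq)
  have "?G ** H = mat 1" "H ** ?G = mat 1"
    using nz unfolding vec_eq_iff forall_2
    by (simp_all add: matrix_matrix_mult_def mat_def sum_2 fund_matrix_def H_def s
        diff_divide_distrib[symmetric] det mult.commute[of "g 2 2 w"] mult.commute[of "g 2 1 w" "g 1 2 w"])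
  then have inv: "?G ** matrix_inv ?G = mat 1 \<and> matrix_inv ?G ** ?G = mat 1"
    unfolding matrix_inv_def
    by (intro someI[where x = H and P = "\<lambda>A'. ?G ** A' = mat 1 \<and> A' ** ?G = mat 1"] conjI)
  then show "?G ** matrix_inv ?G = mat 1" "matrix_inv ?G ** ?G = mat 1" by simp_all
  from inv have "matrix_inv ?G = H"
    using \<open>H ** ?G = mat 1\<close> by (metis matrix_mul_assoc matrix_mul_lid matrix_mul_rid)
  then show "g_inv f 1 1 w = g 2 2 w / gd w" "g_inv f 1 2 w = - g 1 2 w / gd w"
    "g_inv f 2 1 w = - g 2 1 w / gd w" "g_inv f 2 2 w = g 1 1 w / gd w"
    by (simp_all add: g_inv_def H_def s)
qed

lemma g_inv_right: "w \<in> S \<Longrightarrow> (\<Sum>i\<in>UNIV. g_inv f l i w * g i m w) = (if l = m then 1 else 0)"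
  and g_inv_left: "w \<in> S \<Longrightarrow> (\<Sum>m\<in>UNIV. g j m w * g_inv f m i w) = (if j = i then 1 else 0)"
  using fund_matrix_inv[of w]
  by (simp_all add: vec_eq_iff matrix_matrix_mult_def mat_def fund_matrix_def g_inv_def)

lemma smooth_g_inv: "smooth_on S (g_inv f m i)"
proof -
  have "smooth_on S (\<lambda>w. g 2 2 w / gd w)" "smooth_on S (\<lambda>w. - g 1 2 w / gd w)"
    "smooth_on S (\<lambda>w. - g 2 1 w / gd w)" "smooth_on S (\<lambda>w. g 1 1 w / gd w)"
    by (intro smooth_on_divide smooth_on_minus open_S smooth_basic gd_nonzero; assumption)+
  then have "smooth_on S (g_inv f 1 1)" "smooth_on S (g_inv f 1 2)"
    "smooth_on S (g_inv f 2 1)" "smooth_on S (g_inv f 2 2)"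
    by (auto intro: smooth_on_cong[OF open_S g_inv_eq(1)[symmetric]] smooth_on_cong[OF open_S g_inv_eq(2)[symmetric]]
        smooth_on_cong[OF open_S g_inv_eq(3)[symmetric]] smooth_on_cong[OF open_S g_inv_eq(4)[symmetric]])
  then show ?thesis
    using exhaust_2[of m] exhaust_2[of i] by auto
qed

text \<open>Contraction with the inverse matrix undoes the lowering. Identities for the connection
  are proved with the upper index lowered, so that no derivative of the inverse matrix has to be
  computed.\<close>

lemma g_cancel:
  assumes w: "w \<in> S" and eq: "\<And>m. (\<Sum>i\<in>UNIV. x i * g i m w) = (\<Sum>i\<in>UNIV. y i * g i m w)"
  shows "x i = y i"
proof -
  have "x i = (\<Sum>m\<in>UNIV. (\<Sum>j\<in>UNIV. x j * g j m w) * g_inv f m i w)" for x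
  proof -
    have "(\<Sum>m\<in>UNIV. (\<Sum>j\<in>UNIV. x j * g j m w) * g_inv f m i w) =
        (\<Sum>j\<in>UNIV. x j * (\<Sum>m\<in>UNIV. g j m w * g_inv f m i w))"
      by (simp add: sum_2 algebra_simps)
    then show ?thesis
      by (simp add: g_inv_left[OF w] if_distrib cong: if_cong)
  qed
  from this[of x] this[of y] show ?thesis by (simp add: eq)
qed


section \<open>Homogeneity\<close>

lemma differentiable_smooth: "smooth_on S u \<Longrightarrow> w \<in> S \<Longrightarrow> u differentiable (at w)"
  by (rule smooth_on_imp_differentiable)

text \<open>Along the curve (1 + t c) eta the function F^2 is multiplied by |1 + t c|^2. This factor
  is (1 + t)^2 for c = 1 and 1 + t^2 for c = i, with derivatives 2 and 0 at t = 0.\<close>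

lemma LL_directions:
  assumes w: "(z, \<eta>) \<in> S"
  shows "frechet_derivative LL (at (z, \<eta>)) (0, \<eta>) = 2 * LL (z, \<eta>)"
    "frechet_derivative LL (at (z, \<eta>)) (0, \<i> *s \<eta>) = 0"
proof -
  have z: "z \<in> U" using w by (simp add: S_def)
  note d = differentiable_smooth[OF smooth_LL w]
  have *: "frechet_derivative LL (at (z, \<eta>)) (0, c *s \<eta>) = v * LL (z, \<eta>)"
    if v: "((\<lambda>t. complex_of_real ((cmod (1 + of_real t * c))\<^sup>2)) has_vector_derivative v) (at 0)" for c v
  proof -
    have "((\<lambda>t. (z, \<eta> + t *\<^sub>R (c *s \<eta>))) has_derivative (\<lambda>t. (0, t *\<^sub>R (c *s \<eta>)))) (at 0)"
      by (auto intro!: derivative_eq_intros)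
    from diff_chain_at[OF this, of LL] d frechet_derivative_works
    have 1: "((\<lambda>t. LL (z, \<eta> + t *\<^sub>R (c *s \<eta>))) has_derivative
        (\<lambda>t. frechet_derivative LL (at (z, \<eta>)) (0, t *\<^sub>R (c *s \<eta>)))) (at 0)"
      by (fastforce simp: o_def)
    have "frechet_derivative LL (at (z, \<eta>)) (0, t *\<^sub>R v) = t *\<^sub>R frechet_derivative LL (at (z, \<eta>)) (0, v)"
      for t v
      using linear_cmul[OF linear_frechet_derivative[OF d], of t "(0, v)"] by simp
    with 1 have 1: "((\<lambda>t. LL (z, \<eta> + t *\<^sub>R (c *s \<eta>))) has_vector_derivative
        frechet_derivative LL (at (z, \<eta>)) (0, c *s \<eta>)) (at 0)"
      by (simp add: has_vector_derivative_def)
    have "\<eta> + t *\<^sub>R (c *s \<eta>) = (1 + of_real t * c) *s \<eta>" for t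
      by (simp add: vec_eq_iff) (simp add: scaleR_conv_of_real algebra_simps)
    then have "LL (z, \<eta> + t *\<^sub>R (c *s \<eta>)) = complex_of_real ((cmod (1 + of_real t * c))\<^sup>2) * LL (z, \<eta>)" for t
      using scaling[OF z, of "1 + of_real t * c" \<eta>] by (simp add: LL_def power_mult_distrib)
    with 1 have "((\<lambda>t. complex_of_real ((cmod (1 + of_real t * c))\<^sup>2) * LL (z, \<eta>)) has_vector_derivative
        frechet_derivative LL (at (z, \<eta>)) (0, c *s \<eta>)) (at 0)"
      by simp
    moreover have "((\<lambda>t. complex_of_real ((cmod (1 + of_real t * c))\<^sup>2) * LL (z, \<eta>)) has_vector_derivative
        v * LL (z, \<eta>)) (at 0)"
      by (rule has_vector_derivative_mult_left[OF v])
    ultimately show ?thesis by (rule vector_derivative_unique_at)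
  qed
  have "((\<lambda>t. (1 + t)\<^sup>2) has_real_derivative 2) (at 0)" "((\<lambda>t. 1 + t\<^sup>2) has_real_derivative 0) (at 0)"
    by (auto intro!: derivative_eq_intros)
  note v = this[THEN has_vector_derivative_of_real]
  show "frechet_derivative LL (at (z, \<eta>)) (0, \<eta>) = 2 * LL (z, \<eta>)"
    using *[of 1 2] v(1) by (simp add: cmod_power2)
  show "frechet_derivative LL (at (z, \<eta>)) (0, \<i> *s \<eta>) = 0"
    using *[of \<i> 0] v(2) by (simp add: cmod_power2)
qed

text \<open>Since the derivative along i eta vanishes, both Euler operators return half of the
  radial derivative 2 F^2.\<close>

lemma euler_LL: "w \<in> S \<Longrightarrow> (\<Sum>k\<in>UNIV. snd w $ k * d_eta k LL w) = LL w"
  and euler_bar_LL: "w \<in> S \<Longrightarrow> (\<Sum>k\<in>UNIV. cnj (snd w $ k) * d_etabar k LL w) = LL w"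
  using d_eta_euler[of LL "fst w" "snd w"] d_etabar_euler[of LL "fst w" "snd w"]
    LL_directions[of "fst w" "snd w"] differentiable_smooth[OF smooth_LL, of w] by simp_all

lemma sum_kronecker:
  fixes h :: "2 \<Rightarrow> complex"
  shows "(\<Sum>k\<in>UNIV. (if k = i then 1 else 0) * h k) = h i" "(\<Sum>k\<in>UNIV. (if i = k then 1 else 0) * h k) = h i"
    "(\<Sum>k\<in>UNIV. h k * (if k = i then 1 else 0)) = h i" "(\<Sum>k\<in>UNIV. h k * (if i = k then 1 else 0)) = h i"
  using exhaust_2[of i] by (auto simp: sum_2)

lemma derivation_sum_mult:
  assumes "derivation_at w D" "w \<in> S" "\<And>k. smooth_on S (u k)" "\<And>k. smooth_on S (v k)"
  shows "D (\<lambda>y. \<Sum>k\<in>(UNIV::2 set). u k y * v k y) = (\<Sum>k\<in>UNIV. D (u k) * v k w + u k w * D (v k))"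
  using assms
  by (simp add: derivation_sum[OF assms(1)] derivation_mult[OF assms(1)] differentiable_smooth differentiable_mult)

lemma euler_detabar_LL:
  assumes w: "w \<in> S"
  shows "(\<Sum>k\<in>UNIV. snd w $ k * g k j w) = d_etabar j LL w"
proof -
  note D = derivation_at_d_etabar[of w j]
  have "d_etabar j LL w = d_etabar j (\<lambda>y. \<Sum>k\<in>UNIV. snd y $ k * d_eta k LL y) w"
    by (rule derivation_cong[OF D open_S w]) (simp add: euler_LL)
  also have "\<dots> = (\<Sum>k\<in>UNIV. snd w $ k * d_etabar j (d_eta k LL) w)"
    using derivation_sum_mult[OF D w, of "\<lambda>k y. snd y $ k" "\<lambda>k. d_eta k LL"]
    by (simp add: smooth_basic d_etabar_fibre_coord)
  also have "\<dots> = (\<Sum>k\<in>UNIV. snd w $ k * g k j w)"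
    by (simp add: g_LL d_eta_d_etabar_commute[OF open_S w smooth_LL])
  finally show ?thesis by simp
qed

lemma euler_bar_deta_LL:
  assumes w: "w \<in> S"
  shows "(\<Sum>j\<in>UNIV. cnj (snd w $ j) * g i j w) = d_eta i LL w"
proof -
  note D = derivation_at_d_eta[of w i]
  have "d_eta i LL w = d_eta i (\<lambda>y. \<Sum>k\<in>UNIV. cnj (snd y $ k) * d_etabar k LL y) w"
    by (rule derivation_cong[OF D open_S w]) (simp add: euler_bar_LL)
  also have "\<dots> = (\<Sum>k\<in>UNIV. cnj (snd w $ k) * d_eta i (d_etabar k LL) w)"
    using derivation_sum_mult[OF D w, of "\<lambda>k y. cnj (snd y $ k)" "\<lambda>k. d_etabar k LL"]
    by (simp add: smooth_basic d_eta_cnj_fibre_coord)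
  finally show ?thesis by (simp add: g_LL)
qed

lemma euler_bar_deta_g:
  assumes w: "w \<in> S"
  shows "(\<Sum>j\<in>UNIV. cnj (snd w $ j) * d_eta k (g i j) w) = d_eta k (d_eta i LL) w"
proof -
  note D = derivation_at_d_eta[of w k]
  have "d_eta k (d_eta i LL) w = d_eta k (\<lambda>y. \<Sum>j\<in>UNIV. cnj (snd y $ j) * g i j y) w"
    by (rule derivation_cong[OF D open_S w]) (simp add: euler_bar_deta_LL)
  also have "\<dots> = (\<Sum>j\<in>UNIV. cnj (snd w $ j) * d_eta k (g i j) w)"
    using derivation_sum_mult[OF D w, of "\<lambda>k y. cnj (snd y $ k)" "g i"]
    by (simp add: smooth_basic d_eta_cnj_fibre_coord)
  finally show ?thesis by simp
qed

text \<open>Differentiating Euler's identity by eta^i also hits the coordinate eta^i. The extra term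
  is the first derivative of F^2 itself and cancels the left-hand side.\<close>

lemma euler_deta_LL:
  assumes w: "w \<in> S"
  shows "(\<Sum>k\<in>UNIV. snd w $ k * d_eta k (d_eta i LL) w) = 0"
proof -
  note D = derivation_at_d_eta[of w i]
  have "d_eta i LL w = d_eta i (\<lambda>y. \<Sum>k\<in>UNIV. snd y $ k * d_eta k LL y) w"
    by (rule derivation_cong[OF D open_S w]) (simp add: euler_LL)
  also have "\<dots> = (\<Sum>k\<in>UNIV. (if k = i then 1 else 0) * d_eta k LL w + snd w $ k * d_eta i (d_eta k LL) w)"
    using derivation_sum_mult[OF D w, of "\<lambda>k y. snd y $ k" "\<lambda>k. d_eta k LL"]
    by (simp add: smooth_basic d_eta_fibre_coord)
  also have "\<dots> = d_eta i LL w + (\<Sum>k\<in>UNIV. snd w $ k * d_eta i (d_eta k LL) w)"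
    by (simp add: sum.distrib sum_kronecker)
  finally show ?thesis
    by (simp add: d_eta_d_eta_commute[OF open_S w smooth_LL, of i])
qed

text \<open>Both sides are third derivatives of F^2, once by eta-bar and twice by eta.\<close>

lemma deta_g_symmetric: "w \<in> S \<Longrightarrow> d_eta k (g i j) w = d_eta i (g k j) w"
  unfolding g_LL by (rule d_eta_d_eta_commute[OF open_S _ smooth_detabar[OF smooth_LL]])

lemma euler_deta_g:
  assumes w: "w \<in> S"
  shows "(\<Sum>i\<in>UNIV. snd w $ i * d_eta k (g i j) w) = 0"
proof -
  note D = derivation_at_d_eta[of w k]
  have "d_eta k (d_etabar j LL) w = d_eta k (\<lambda>y. \<Sum>i\<in>UNIV. snd y $ i * g i j y) w"
    by (rule derivation_cong[OF D open_S w]) (simp add: euler_detabar_LL)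
  also have "\<dots> = (\<Sum>i\<in>UNIV. (if i = k then 1 else 0) * g i j w + snd w $ i * d_eta k (g i j) w)"
    using derivation_sum_mult[OF D w, of "\<lambda>k y. snd y $ k" "\<lambda>i. g i j"]
    by (simp add: smooth_basic d_eta_fibre_coord)
  also have "\<dots> = g k j w + (\<Sum>i\<in>UNIV. snd w $ i * d_eta k (g i j) w)"
    by (simp add: sum.distrib sum_kronecker)
  finally show ?thesis by (simp add: g_LL)
qed

lemma euler_g: "w \<in> S \<Longrightarrow> (\<Sum>k\<in>UNIV. snd w $ k * d_eta k (g i j) w) = 0"
  using euler_deta_g[of w i j] by (simp add: deta_g_symmetric[of w i])

lemma euler_gd:
  assumes w: "w \<in> S"
  shows "(\<Sum>k\<in>UNIV. snd w $ k * d_eta k gd w) = 0"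
proof -
  note D = derivation_at_d_eta[of w]
  have "d_eta k gd w = d_eta k (g 1 1) w * g 2 2 w + g 1 1 w * d_eta k (g 2 2) w -
      (d_eta k (g 1 2) w * g 2 1 w + g 1 2 w * d_eta k (g 2 1) w)" for k
    unfolding gd_eq using differentiable_smooth[OF smooth_g w]
    by (simp add: derivation_diff[OF D] derivation_mult[OF D] differentiable_mult)
  then have "(\<Sum>k\<in>UNIV. snd w $ k * d_eta k gd w) =
      (\<Sum>k\<in>UNIV. snd w $ k * d_eta k (g 1 1) w) * g 2 2 w + g 1 1 w * (\<Sum>k\<in>UNIV. snd w $ k * d_eta k (g 2 2) w) -
      ((\<Sum>k\<in>UNIV. snd w $ k * d_eta k (g 1 2) w) * g 2 1 w + g 1 2 w * (\<Sum>k\<in>UNIV. snd w $ k * d_eta k (g 2 1) w))"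
    by (simp only: sum_2) (simp add: algebra_simps)
  then show ?thesis by (simp add: euler_g[OF w])
qed


section \<open>The connection coefficients\<close>

abbreviation N :: "2 \<Rightarrow> 2 \<Rightarrow> 2 coord_fun" where "N \<equiv> N_conn f"

lemma smooth_N: "smooth_on S (N i k)"
proof -
  have "smooth_on S (\<lambda>w. \<Sum>m\<in>UNIV. \<Sum>l\<in>UNIV. g_inv f m i w * d_z k (g l m) w * snd w $ l)"
    by (intro smooth_on_sum smooth_on_mult open_S smooth_basic smooth_g_inv)
  then show ?thesis by (simp add: N_conn_def[abs_def])
qed

lemma N_lowered:
  assumes w: "w \<in> S"
  shows "(\<Sum>i\<in>UNIV. N i k w * g i m w) = (\<Sum>l\<in>UNIV. d_z k (g l m) w * snd w $ l)"
proof -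
  have "(\<Sum>i\<in>UNIV. N i k w * g i m w) =
      (\<Sum>n\<in>UNIV. (\<Sum>i\<in>UNIV. g_inv f n i w * g i m w) * (\<Sum>l\<in>UNIV. d_z k (g l n) w * snd w $ l))"
    by (simp add: N_conn_def sum_2 algebra_simps)
  then show ?thesis
    by (simp add: g_inv_right[OF w] sum_kronecker)
qed

lemma L_lowered:
  assumes w: "w \<in> S"
  shows "(\<Sum>i\<in>UNIV. L_conn f i j k w * g i m w) = delta_h f k (g j m) w"
proof -
  have "(\<Sum>i\<in>UNIV. L_conn f i j k w * g i m w) =
      (\<Sum>n\<in>UNIV. (\<Sum>i\<in>UNIV. g_inv f n i w * g i m w) * delta_h f k (g j n) w)"
    by (simp add: L_conn_def sum_2 algebra_simps)
  then show ?thesis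
    by (simp add: g_inv_right[OF w] sum_kronecker)
qed

text \<open>The lowered form of N^i_k is differentiated by eta^j. On the right only the derivative
  of eta^l survives and gives the z-derivative of g; on the left the symmetry of the derivative of g
  turns the second term into the fibre part of \<open>delta_h\<close>.\<close>

lemma deta_N_lowered:
  assumes w: "w \<in> S"
  shows "(\<Sum>i\<in>UNIV. d_eta j (N i k) w * g i m w) = delta_h f k (g j m) w"
proof -
  note D = derivation_at_d_eta[of w j]
  have "d_eta j (\<lambda>y. \<Sum>i\<in>UNIV. N i k y * g i m y) w = d_eta j (\<lambda>y. \<Sum>l\<in>UNIV. d_z k (g l m) y * snd y $ l) w"
    by (rule derivation_cong[OF D open_S w]) (simp add: N_lowered)
  moreover have "d_eta j (\<lambda>y. \<Sum>i\<in>UNIV. N i k y * g i m y) w =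
      (\<Sum>i\<in>UNIV. d_eta j (N i k) w * g i m w + N i k w * d_eta j (g i m) w)"
    by (rule derivation_sum_mult[OF D w]) (intro smooth_N smooth_basic)+
  moreover have "d_eta j (\<lambda>y. \<Sum>l\<in>UNIV. d_z k (g l m) y * snd y $ l) w =
      (\<Sum>l\<in>UNIV. d_eta j (d_z k (g l m)) w * snd w $ l + d_z k (g l m) w * d_eta j (\<lambda>y. snd y $ l) w)"
    by (rule derivation_sum_mult[OF D w]) (intro smooth_basic)+
  \<comment> \<open>This is the z^k-derivative of \<open>euler_deta_g\<close>, because eta does not
    depend on z.\<close>
  moreover have "(\<Sum>l\<in>UNIV. d_eta j (d_z k (g l m)) w * snd w $ l) = 0"
  proof -
    note Dz = derivation_at_d_z[of w k]
    have "d_z k (\<lambda>y. \<Sum>l\<in>UNIV. d_eta j (g l m) y * snd y $ l) w = d_z k (\<lambda>y. 0) w"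
      by (rule derivation_cong[OF Dz open_S w]) (use euler_deta_g in \<open>simp add: mult.commute\<close>)
    also have "\<dots> = 0" by (rule derivation_const[OF Dz])
    also have "d_z k (\<lambda>y. \<Sum>l\<in>UNIV. d_eta j (g l m) y * snd y $ l) w =
      (\<Sum>l\<in>UNIV. d_z k (d_eta j (g l m)) w * snd w $ l + d_eta j (g l m) w * d_z k (\<lambda>y. snd y $ l) w)"
      by (rule derivation_sum_mult[OF Dz w]) (intro smooth_basic)+
    finally show ?thesis
      by (simp add: d_z_fibre_coord d_eta_d_z_commute[OF open_S w smooth_g])
  qed
  ultimately show ?thesis
    by (simp add: delta_h_def d_eta_fibre_coord sum.distrib deta_g_symmetric[OF w, of j] sum_kronecker
        algebra_simps)
qed

lemma L_conn_eq: "w \<in> S \<Longrightarrow> L_conn f i j k w = d_eta j (N i k) w"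
  using g_cancel[of w "\<lambda>i. L_conn f i j k w" "\<lambda>i. d_eta j (N i k) w"]
  by (simp add: L_lowered deta_N_lowered)

text \<open>Contracting the lowered derivative \<open>delta_h f k (g j m)\<close> with eta^j kills
  its fibre part by \<open>euler_deta_g\<close>; the z-part that remains is the lowered
  N^i_k.\<close>

lemma euler_N:
  assumes w: "w \<in> S"
  shows "(\<Sum>j\<in>UNIV. snd w $ j * d_eta j (N i k) w) = N i k w"
proof (rule g_cancel[OF w, where x = "\<lambda>i. \<Sum>j\<in>UNIV. snd w $ j * d_eta j (N i k) w" and y = "\<lambda>i. N i k w"])
  fix m
  have "(\<Sum>i\<in>UNIV. (\<Sum>j\<in>UNIV. snd w $ j * d_eta j (N i k) w) * g i m w) =
      (\<Sum>j\<in>UNIV. snd w $ j * (\<Sum>i\<in>UNIV. d_eta j (N i k) w * g i m w))"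
    by (simp add: sum_2 algebra_simps)
  also have "\<dots> = (\<Sum>l\<in>UNIV. d_z k (g l m) w * snd w $ l) -
      (\<Sum>i\<in>UNIV. N i k w * (\<Sum>j\<in>UNIV. snd w $ j * d_eta i (g j m) w))"
    unfolding deta_N_lowered[OF w] delta_h_def by (simp add: sum_2 algebra_simps)
  finally show "(\<Sum>i\<in>UNIV. (\<Sum>j\<in>UNIV. snd w $ j * d_eta j (N i k) w) * g i m w) = (\<Sum>i\<in>UNIV. N i k w * g i m w)"
    by (simp add: euler_deta_g[OF w] N_lowered[OF w])
qed

text \<open>The trace \<open>L\<^sup>i\<^sub>i\<^sub>k\<close>, which equals \<open>\<delta>\<^sub>k (ln g)\<close>.\<close>

definition \<Lambda> :: "2 \<Rightarrow> 2 coord_fun" where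
  "\<Lambda> k w = (\<Sum>i\<in>UNIV. d_eta i (N i k) w)"

lemma smooth_\<Lambda>: "smooth_on S (\<Lambda> k)"
proof -
  have "smooth_on S (\<lambda>w. \<Sum>i\<in>UNIV. d_eta i (N i k) w)"
    by (intro smooth_on_sum smooth_basic smooth_N open_S)
  then show ?thesis by (simp add: \<Lambda>_def[abs_def])
qed

lemma euler_\<Lambda>:
  assumes w: "w \<in> S"
  shows "deriv_0 (\<Lambda> k) w = 0"
proof -
  have "(\<Sum>j\<in>UNIV. snd w $ j * d_eta j (d_eta i (N i k)) w) = 0" for i
  proof -
    note D = derivation_at_d_eta[of w i]
    have "d_eta i (N i k) w = d_eta i (\<lambda>y. \<Sum>j\<in>UNIV. snd y $ j * d_eta j (N i k) y) w"
      by (rule derivation_cong[OF D open_S w]) (simp add: euler_N)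
    also have "\<dots> = (\<Sum>j\<in>UNIV. d_eta i (\<lambda>y. snd y $ j) w * d_eta j (N i k) w + snd w $ j * d_eta i (d_eta j (N i k)) w)"
      by (rule derivation_sum_mult[OF D w]) (intro smooth_basic smooth_N)+
    also have "\<dots> = d_eta i (N i k) w + (\<Sum>j\<in>UNIV. snd w $ j * d_eta i (d_eta j (N i k)) w)"
      by (simp add: d_eta_fibre_coord sum.distrib sum_kronecker)
    finally show ?thesis
      by (simp add: d_eta_d_eta_commute[OF open_S w smooth_N, of i])
  qed
  moreover have "deriv_0 (\<Lambda> k) w = (\<Sum>i\<in>UNIV. (\<Sum>j\<in>UNIV. snd w $ j * d_eta j (d_eta i (N i k)) w))"
  proof -
    have "deriv_0 (\<lambda>w. \<Sum>i\<in>UNIV. d_eta i (N i k) w) w = (\<Sum>i\<in>UNIV. deriv_0 (d_eta i (N i k)) w)"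
      by (rule derivation_sum[OF derivation_at_deriv_0])
        (intro differentiable_smooth smooth_basic smooth_N w)
    then show ?thesis by (simp add: \<Lambda>_def[abs_def] deriv_0_def)
  qed
  ultimately show ?thesis by simp
qed

text \<open>Jacobi's formula for the derivative of a determinant. With \<open>delta_h\<close> it
  yields the trace of L^i_{jk}, with \<open>d_eta\<close> the trace of C^i_{jk}.\<close>

lemma trace_derivation:
  assumes w: "w \<in> S" and D: "derivation_at w D"
  shows "(\<Sum>i\<in>UNIV. \<Sum>l\<in>UNIV. g_inv f l i w * D (g i l)) * gd w = D gd"
proof -
  have "D gd = D (g 1 1) * g 2 2 w + g 1 1 w * D (g 2 2) - (D (g 1 2) * g 2 1 w + g 1 2 w * D (g 2 1))"
    unfolding gd_eq using differentiable_smooth[OF smooth_g w]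
    by (simp add: derivation_diff[OF D] derivation_mult[OF D] differentiable_mult)
  with gd_nonzero[OF w] show ?thesis
    by (simp add: sum_2 g_inv_eq[OF w] distrib_right) (simp add: algebra_simps)
qed

lemma delta_gd:
  assumes w: "w \<in> S"
  shows "delta_h f k gd w = gd w * \<Lambda> k w"
  using trace_derivation[OF w derivation_at_delta_h[of w f k]] L_conn_eq[OF w]
  by (simp add: \<Lambda>_def L_conn_def mult.commute[of "gd w"] flip: L_conn_eq[OF w])

text \<open>Write F^2 as eta-bar^m times its eta-bar^m-derivative. The z-derivative of the latter is
  N^i_k with its index lowered, so contraction with eta-bar^m reproduces exactly the fibre part of
  \<open>delta_h\<close>. Hence F is constant for delta_k.\<close>

lemma delta_LL:
  assumes w: "w \<in> S"
  shows "delta_h f k LL w = 0"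
proof -
  note D = derivation_at_d_z[of w k]
  have "d_z k (d_etabar m LL) w = (\<Sum>l\<in>UNIV. d_z k (g l m) w * snd w $ l)" for m
  proof -
    have "d_z k (d_etabar m LL) w = d_z k (\<lambda>y. \<Sum>l\<in>UNIV. g l m y * snd y $ l) w"
      by (rule derivation_cong[OF D open_S w]) (use euler_detabar_LL in \<open>simp add: mult.commute\<close>)
    also have "\<dots> = (\<Sum>l\<in>UNIV. d_z k (g l m) w * snd w $ l + g l m w * d_z k (\<lambda>y. snd y $ l) w)"
      by (rule derivation_sum_mult[OF D w]) (intro smooth_basic)+
    finally show ?thesis by (simp add: d_z_fibre_coord)
  qed
  then have 1: "d_z k (d_etabar m LL) w = (\<Sum>i\<in>UNIV. N i k w * g i m w)" for m
    by (simp add: N_lowered[OF w])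
  have "d_z k LL w = d_z k (\<lambda>y. \<Sum>m\<in>UNIV. cnj (snd y $ m) * d_etabar m LL y) w"
    by (rule derivation_cong[OF D open_S w]) (simp add: euler_bar_LL)
  also have "\<dots> = (\<Sum>m\<in>UNIV. d_z k (\<lambda>y. cnj (snd y $ m)) w * d_etabar m LL w + cnj (snd w $ m) * d_z k (d_etabar m LL) w)"
    by (rule derivation_sum_mult[OF D w]) (intro smooth_basic)+
  also have "\<dots> = (\<Sum>i\<in>UNIV. N i k w * (\<Sum>m\<in>UNIV. cnj (snd w $ m) * g i m w))"
    by (simp add: d_z_cnj_fibre_coord 1 sum_2 algebra_simps)
  finally show ?thesis
    by (simp add: delta_h_def euler_bar_deta_LL[OF w])
qed

text \<open>Coordinate derivatives commute; the only defect comes from the fibre derivative hitting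
  the coefficients N^i_k.\<close>

lemma delta_deta_commute:
  assumes w: "w \<in> S" and u: "smooth_on S u"
  shows "delta_h f k (d_eta j u) w = d_eta j (delta_h f k u) w + (\<Sum>i\<in>UNIV. d_eta j (N i k) w * d_eta i u w)"
proof -
  note D = derivation_at_d_eta[of w j]
  have "d_eta j (\<lambda>w. d_z k u w - (\<Sum>i\<in>UNIV. N i k w * d_eta i u w)) w =
      d_eta j (d_z k u) w - d_eta j (\<lambda>w. \<Sum>i\<in>UNIV. N i k w * d_eta i u w) w"
    by (rule derivation_diff[OF D])
      (intro differentiable_smooth[OF _ w] smooth_basic smooth_on_sum smooth_on_mult open_S smooth_N u)+
  also have "d_eta j (\<lambda>w. \<Sum>i\<in>UNIV. N i k w * d_eta i u w) w =
      (\<Sum>i\<in>UNIV. d_eta j (N i k) w * d_eta i u w + N i k w * d_eta j (d_eta i u) w)"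
    by (rule derivation_sum_mult[OF D w]) (intro smooth_N smooth_basic u)+
  finally show ?thesis
    by (simp add: delta_h_def[abs_def] sum.distrib d_eta_d_z_commute[OF open_S w u]
        d_eta_d_eta_commute[OF open_S w u, of j])
qed


section \<open>The local frame\<close>


abbreviation s :: "2 coord_fun" where "s \<equiv> sqrt_g f"

lemma s_square: "s w * s w = gd w"
  unfolding sqrt_g_def gd_def by (metis power2_csqrt power2_eq_square)

lemma s_nonzero: "w \<in> S \<Longrightarrow> s w \<noteq> 0"
  using s_square[of w] gd_nonzero[of w] by auto

text \<open>The determinant is a positive real number, hence off the branch cut of
  \<open>csqrt\<close>.\<close>

lemma differentiable_s: "w \<in> S \<Longrightarrow> s differentiable (at w)"
  using differentiable_csqrt[OF differentiable_smooth[OF smooth_gd], of w] gd_pos[of w]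
  by (simp add: sqrt_g_def[abs_def] gd_def complex_nonpos_Reals_iff)

text \<open>Smoothness is given for the square only, so F is recovered as the principal root of a
  positive function.\<close>

lemma differentiable_\<phi>:
  assumes w: "w \<in> S"
  shows "\<phi> differentiable (at w)"
proof (rule differentiable_cong_open[OF open_S w])
  have fpos: "0 < f y" if "y \<in> S" for y using pos[of y] that by (simp add: S_def)
  show "csqrt (LL y) = \<phi> y" if "y \<in> S" for y
    using fpos[OF that] by (simp add: LL_def flip: of_real_power)
  show "(\<lambda>y. csqrt (LL y)) differentiable (at w)"
    using fpos[OF w] w by (intro differentiable_csqrt differentiable_smooth[OF smooth_LL])
      (simp_all add: LL_def complex_nonpos_Reals_iff)
qed

lemma derivation_\<phi>:
  assumes w: "w \<in> S" and D: "derivation_at w D"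
  shows "D \<phi> = D LL / (2 * \<phi> w)"
  using derivation_sqrt[OF D open_S w _ differentiable_\<phi>[OF w] \<phi>_nonzero[OF w]] LL_square
  by metis

lemma derivation_s:
  assumes w: "w \<in> S" and D: "derivation_at w D"
  shows "D s = D gd / (2 * s w)"
  using derivation_sqrt[OF D open_S w _ differentiable_s[OF w] s_nonzero[OF w]] s_square by simp

lemma l_dn_eq: "w \<in> S \<Longrightarrow> l_dn f i w = d_eta i LL w / \<phi> w"
  by (simp add: l_dn_def mult.commute flip: euler_bar_deta_LL)

lemma deta_LL: "w \<in> S \<Longrightarrow> d_eta i LL w = \<phi> w * l_dn f i w"
  using \<phi>_nonzero[of w] by (simp add: l_dn_eq)

lemma l_contract: "w \<in> S \<Longrightarrow> l_up f 1 w * l_dn f 1 w + l_up f 2 w * l_dn f 2 w = 1"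
  using euler_LL[of w] \<phi>_nonzero[of w] LL_square[of w]
  by (simp add: sum_2 l_up_def l_dn_eq field_simps)

text \<open>The vectors m are the covectors l rotated and rescaled by sqrt g. The off-diagonal
  entries therefore cancel, and each diagonal entry is the single contraction l^i l_i = 1.\<close>

lemma frame_complete:
  assumes w: "w \<in> S"
  shows "l_up f j w * l_dn f i w + m_up f j w * m_dn f i w = (if i = j then 1 else 0)"
  using l_contract[OF w] s_nonzero[OF w] exhaust_2[of i] exhaust_2[of j]
  by (auto simp: m_up_def m_dn_def algebra_simps)

lemma m_contract: "w \<in> S \<Longrightarrow> m_up f 1 w * m_dn f 1 w + m_up f 2 w * m_dn f 2 w = 1"
  using l_contract[of w] s_nonzero[of w] by (simp add: m_up_def m_dn_def algebra_simps)

lemma m_l_contract: "m_up f 1 w * l_dn f 1 w + m_up f 2 w * l_dn f 2 w = 0"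
  by (simp add: m_up_def)

section \<open>Expansions in the frame and traces\<close>

lemma covector_expand:
  assumes w: "w \<in> S"
  shows "x k = (\<Sum>j\<in>UNIV. l_up f j w * x j) * l_dn f k w + (\<Sum>j\<in>UNIV. m_up f j w * x j) * m_dn f k w"
proof -
  have "(\<Sum>j\<in>UNIV. (if k = j then 1 else 0) * x j) =
      (\<Sum>j\<in>UNIV. (l_up f j w * l_dn f k w + m_up f j w * m_dn f k w) * x j)"
    by (simp only: frame_complete[OF w])
  then show ?thesis by (simp add: sum_kronecker sum_2 algebra_simps)
qed

text \<open>The diagonal frame components of a matrix add up to its trace. This is why J occurs only
  together with Y, and V with H.\<close>

lemma frame_trace:
  assumes w: "w \<in> S"
  shows "(\<Sum>j\<in>UNIV. \<Sum>i\<in>UNIV. l_up f j w * l_dn f i w * M i j) +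
    (\<Sum>j\<in>UNIV. \<Sum>i\<in>UNIV. m_up f j w * m_dn f i w * M i j) = (\<Sum>i\<in>UNIV. M i i)"
proof -
  have "(\<Sum>j\<in>UNIV. \<Sum>i\<in>UNIV. l_up f j w * l_dn f i w * M i j) +
    (\<Sum>j\<in>UNIV. \<Sum>i\<in>UNIV. m_up f j w * m_dn f i w * M i j) =
    (\<Sum>j\<in>UNIV. \<Sum>i\<in>UNIV. (l_up f j w * l_dn f i w + m_up f j w * m_dn f i w) * M i j)"
    by (simp add: distrib_right sum.distrib)
  then show ?thesis by (simp add: frame_complete[OF w] sum_kronecker)
qed

lemma \<Lambda>_trace: "w \<in> S \<Longrightarrow> \<Lambda> k w = (\<Sum>i\<in>UNIV. L_conn f i i k w)"
  by (simp add: \<Lambda>_def L_conn_eq)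

lemma JY_eq:
  assumes w: "w \<in> S"
  shows "fin_JY f w = (\<Sum>k\<in>UNIV. l_up f k w * \<Lambda> k w)"
proof -
  have "fin_JY f w = (\<Sum>k\<in>UNIV. l_up f k w *
      ((\<Sum>j\<in>UNIV. \<Sum>i\<in>UNIV. l_up f j w * l_dn f i w * L_conn f i j k w) +
       (\<Sum>j\<in>UNIV. \<Sum>i\<in>UNIV. m_up f j w * m_dn f i w * L_conn f i j k w)))"
    by (simp add: fin_JY_def fin_J_def fin_Y_def sum_2 algebra_simps)
  then show ?thesis
    by (simp only: frame_trace[OF w] \<Lambda>_trace[OF w])
qed

lemma VH_eq:
  assumes w: "w \<in> S"
  shows "fin_VH f w = (\<Sum>k\<in>UNIV. m_up f k w * \<Lambda> k w)"
proof -
  have "fin_VH f w = (\<Sum>k\<in>UNIV. m_up f k w *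
      ((\<Sum>j\<in>UNIV. \<Sum>i\<in>UNIV. l_up f j w * l_dn f i w * L_conn f i j k w) +
       (\<Sum>j\<in>UNIV. \<Sum>i\<in>UNIV. m_up f j w * m_dn f i w * L_conn f i j k w)))"
    by (simp add: fin_VH_def fin_V_def fin_H_def sum_2 algebra_simps)
  then show ?thesis
    by (simp only: frame_trace[OF w] \<Lambda>_trace[OF w])
qed

lemma \<Lambda>_expand: "w \<in> S \<Longrightarrow> \<Lambda> k w = fin_JY f w * l_dn f k w + fin_VH f w * m_dn f k w"
  using covector_expand[of w "\<lambda>k. \<Lambda> k w" k] by (simp add: JY_eq VH_eq)

lemma euler_C:
  assumes w: "w \<in> S"
  shows "(\<Sum>j\<in>UNIV. l_up f j w * C_conn f h j k w) = 0"
proof -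
  have "(\<Sum>j\<in>UNIV. l_up f j w * C_conn f h j k w) =
      (\<Sum>l\<in>UNIV. g_inv f l h w * (\<Sum>j\<in>UNIV. snd w $ j * d_eta k (g j l) w)) / \<phi> w"
    by (simp add: C_conn_def l_up_def sum_2 add_divide_distrib algebra_simps)
  then show ?thesis by (simp add: euler_deta_g[OF w])
qed

text \<open>B is the m-part of the trace of C^h_{jk}, contracted with m^k. The l-part vanishes by
  homogeneity, so B sees the full trace, which is the fibre derivative of ln g.\<close>

lemma B_eq:
  assumes w: "w \<in> S"
  shows "fin_B f w = (\<Sum>k\<in>UNIV. m_up f k w * (d_eta k gd w / gd w))"
proof -
  have tr: "(\<Sum>h\<in>UNIV. C_conn f h h k w) = d_eta k gd w / gd w" for k
    using trace_derivation[OF w derivation_at_d_eta[of w k]] gd_nonzero[OF w]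
    by (simp add: C_conn_def field_simps)
  have "(\<Sum>j\<in>UNIV. \<Sum>h\<in>UNIV. l_up f j w * l_dn f h w * C_conn f h j k w) =
      (\<Sum>h\<in>UNIV. l_dn f h w * (\<Sum>j\<in>UNIV. l_up f j w * C_conn f h j k w))" for k
    by (simp add: sum_2 algebra_simps)
  then have z: "(\<Sum>j\<in>UNIV. \<Sum>h\<in>UNIV. l_up f j w * l_dn f h w * C_conn f h j k w) = 0" for k
    by (simp only: euler_C[OF w]) simp
  have "fin_B f w = (\<Sum>k\<in>UNIV. m_up f k w *
      (\<Sum>j\<in>UNIV. \<Sum>h\<in>UNIV. m_up f j w * m_dn f h w * C_conn f h j k w))"
    by (simp add: fin_B_def sum_2 algebra_simps)
  also have "\<dots> = (\<Sum>k\<in>UNIV. m_up f k w * (\<Sum>h\<in>UNIV. C_conn f h h k w))"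
    using frame_trace[OF w, of "\<lambda>h j. C_conn f h j k w" for k] unfolding z by simp
  finally show ?thesis unfolding tr .
qed

lemma deta_gd:
  assumes w: "w \<in> S"
  shows "d_eta k gd w / gd w = fin_B f w * m_dn f k w"
proof -
  have "(\<Sum>j\<in>UNIV. l_up f j w * (d_eta j gd w / gd w)) = (\<Sum>j\<in>UNIV. snd w $ j * d_eta j gd w) / (\<phi> w * gd w)"
    by (simp add: l_up_def sum_2 add_divide_distrib)
  then show ?thesis
    using covector_expand[OF w, of "\<lambda>k. d_eta k gd w / gd w" k]
    by (simp add: euler_gd[OF w] B_eq[OF w])
qed

text \<open>The covector l_h contains g, which cancels the inverse matrix inside C^h_{kj}; what is
  left is eta-bar contracted with a derivative of g.\<close>

lemma l_C:
  assumes w: "w \<in> S"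
  shows "(\<Sum>h\<in>UNIV. l_dn f h w * C_conn f h k j w) = d_eta j (d_eta k LL) w / \<phi> w"
proof -
  have "(\<Sum>h\<in>UNIV. l_dn f h w * C_conn f h k j w) =
     (\<Sum>l\<in>UNIV. (\<Sum>n\<in>UNIV. (\<Sum>h\<in>UNIV. g_inv f l h w * g h n w) * cnj (snd w $ n)) * d_eta j (g k l) w) / \<phi> w"
    by (simp add: l_dn_def C_conn_def sum_2 add_divide_distrib algebra_simps)
  also have "\<dots> = (\<Sum>l\<in>UNIV. cnj (snd w $ l) * d_eta j (g k l) w) / \<phi> w"
    by (simp add: g_inv_right[OF w] sum_kronecker)
  finally show ?thesis by (simp add: euler_bar_deta_g[OF w])
qed

lemma A_eq:
  assumes w: "w \<in> S"
  shows "\<phi> w * fin_A f w = (\<Sum>k\<in>UNIV. m_up f k w * (\<Sum>j\<in>UNIV. m_up f j w * d_eta j (d_eta k LL) w))"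
proof -
  have "fin_A f w = (\<Sum>k\<in>UNIV. \<Sum>j\<in>UNIV. m_up f k w * m_up f j w * (\<Sum>h\<in>UNIV. l_dn f h w * C_conn f h k j w))"
    by (simp add: fin_A_def sum_2 algebra_simps)
  then show ?thesis
    unfolding l_C[OF w] using \<phi>_nonzero[OF w] by (simp add: sum_2 field_simps)
qed

text \<open>The matrix of second eta-derivatives of F^2 is annihilated by eta in both slots, so only
  its \<open>m_j m_k\<close> component survives. One slot is resolved here, the other in
  \<open>deta_deta_LL\<close>.\<close>

lemma m_deta_deta_LL:
  assumes w: "w \<in> S"
  shows "(\<Sum>j\<in>UNIV. m_up f j w * d_eta j (d_eta k LL) w) = \<phi> w * fin_A f w * m_dn f k w"
proof -
  have "(\<Sum>k\<in>UNIV. l_up f k w * (\<Sum>j\<in>UNIV. m_up f j w * d_eta j (d_eta k LL) w)) =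
      (\<Sum>j\<in>UNIV. m_up f j w * (\<Sum>k\<in>UNIV. snd w $ k * d_eta j (d_eta k LL) w)) / \<phi> w"
    by (simp add: l_up_def sum_2 add_divide_distrib algebra_simps)
  also have "\<dots> = 0"
  proof -
    have "(\<Sum>k\<in>UNIV. snd w $ k * d_eta j (d_eta k LL) w) = 0" for j
      using euler_deta_LL[OF w, of j] by (simp add: d_eta_d_eta_commute[OF open_S w smooth_LL, of j])
    then show ?thesis by simp
  qed
  finally show ?thesis
    using covector_expand[OF w, of "\<lambda>k. \<Sum>j\<in>UNIV. m_up f j w * d_eta j (d_eta k LL) w" k]
    by (simp add: A_eq[OF w])
qed

lemma deta_deta_LL:
  assumes w: "w \<in> S"
  shows "d_eta j (d_eta k LL) w = \<phi> w * fin_A f w * m_dn f j w * m_dn f k w"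
proof -
  have "(\<Sum>j\<in>UNIV. l_up f j w * d_eta j (d_eta k LL) w) = (\<Sum>j\<in>UNIV. snd w $ j * d_eta j (d_eta k LL) w) / \<phi> w"
    by (simp add: l_up_def sum_2 add_divide_distrib)
  then show ?thesis
    using covector_expand[OF w, of "\<lambda>j. d_eta j (d_eta k LL) w" j]
    by (simp add: euler_deta_LL[OF w] m_deta_deta_LL[OF w])
qed

section \<open>Differentiability of the frame and its scalars\<close>

lemma differentiable_fibre_coord: "w \<in> S \<Longrightarrow> (\<lambda>y. snd y $ i) differentiable (at w)"
  by (rule differentiable_smooth[OF smooth_fibre_coord])

lemma differentiable_l_up: "w \<in> S \<Longrightarrow> l_up f i differentiable (at w)"
  unfolding l_up_def[abs_def]
  by (intro differentiable_divide differentiable_fibre_coord differentiable_\<phi> \<phi>_nonzero)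

lemma differentiable_l_dn: "w \<in> S \<Longrightarrow> l_dn f i differentiable (at w)"
  unfolding l_dn_def[abs_def]
  by (intro differentiable_divide differentiable_\<phi> \<phi>_nonzero differentiable_smooth[of "\<lambda>w. \<Sum>j\<in>UNIV. g i j w * cnj (snd w $ j)"]
      smooth_on_sum smooth_on_mult smooth_basic open_S)

lemma differentiable_m_up:
  assumes "w \<in> S"
  shows "m_up f i differentiable (at w)"
  unfolding m_up_def[abs_def]
  by (cases "i = 1") (auto intro!: differentiable_divide differentiable_minus differentiable_l_dn
      differentiable_s s_nonzero assms)

lemma differentiable_m_dn:
  assumes "w \<in> S"
  shows "m_dn f i differentiable (at w)"
  unfolding m_dn_def[abs_def]
  by (cases "i = 1") (auto intro!: differentiable_mult differentiable_minus differentiable_l_up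
      differentiable_s assms)

lemma differentiable_JY:
  assumes w: "w \<in> S"
  shows "fin_JY f differentiable (at w)"
proof (rule differentiable_cong_open[OF open_S w])
  show "(\<lambda>w. \<Sum>k\<in>UNIV. l_up f k w * \<Lambda> k w) differentiable (at w)"
    by (intro differentiable_sum ballI differentiable_mult differentiable_l_up
        differentiable_smooth[OF smooth_\<Lambda>] w) simp_all
qed (simp add: JY_eq)

lemma differentiable_VH:
  assumes w: "w \<in> S"
  shows "fin_VH f differentiable (at w)"
proof (rule differentiable_cong_open[OF open_S w])
  show "(\<lambda>w. \<Sum>k\<in>UNIV. m_up f k w * \<Lambda> k w) differentiable (at w)"
    by (intro differentiable_sum ballI differentiable_mult differentiable_m_up
        differentiable_smooth[OF smooth_\<Lambda>] w) simp_all
qed (simp add: VH_eq)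

lemma differentiable_B:
  assumes w: "w \<in> S"
  shows "fin_B f differentiable (at w)"
proof (rule differentiable_cong_open[OF open_S w])
  show "(\<lambda>w. \<Sum>k\<in>UNIV. m_up f k w * (d_eta k gd w / gd w)) differentiable (at w)"
    by (intro differentiable_sum ballI differentiable_mult differentiable_m_up differentiable_divide
        differentiable_smooth smooth_basic gd_nonzero w) simp_all
qed (simp add: B_eq)

text \<open>With \<open>D\<close> left general, differentiating the frame reduces to a few values of
  \<open>D\<close>: on F, on sqrt g, on eta^i and on the fibre derivatives of F^2. The
  \<open>_basic\<close> lemmas below supply them for each operator, as far as required.\<close>

lemma derivation_l_up:
  assumes w: "w \<in> S" and D: "derivation_at w D"
  shows "D (l_up f i) = (D (\<lambda>y. snd y $ i) - l_up f i w * D \<phi>) / \<phi> w"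
  using derivation_divide[OF D differentiable_fibre_coord[OF w] differentiable_\<phi>[OF w] \<phi>_nonzero[OF w], of i]
    \<phi>_nonzero[OF w]
  by (simp add: l_up_def[abs_def] power2_eq_square field_simps)

lemma derivation_l_dn:
  assumes w: "w \<in> S" and D: "derivation_at w D"
  shows "D (l_dn f i) = (D (d_eta i LL) - l_dn f i w * D \<phi>) / \<phi> w"
proof -
  have "D (l_dn f i) = D (\<lambda>y. d_eta i LL y / \<phi> y)"
    by (rule derivation_cong[OF D open_S w]) (simp add: l_dn_eq)
  also have "\<dots> = (D (d_eta i LL) * \<phi> w - d_eta i LL w * D \<phi>) / (\<phi> w)\<^sup>2"
    by (rule derivation_divide[OF D]) (intro differentiable_smooth smooth_basic differentiable_\<phi> \<phi>_nonzero w)+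
  finally show ?thesis
    using \<phi>_nonzero[OF w] by (simp add: l_dn_eq[OF w] power2_eq_square field_simps)
qed

lemma derivation_m_dn:
  assumes w: "w \<in> S" and D: "derivation_at w D"
  shows "D (m_dn f 1) = - (D s * l_up f 2 w + s w * D (l_up f 2))"
    "D (m_dn f 2) = D s * l_up f 1 w + s w * D (l_up f 1)"
  using derivation_mult[OF D differentiable_s[OF w] differentiable_l_up[OF w]]
    derivation_minus[OF D differentiable_mult[OF differentiable_s[OF w] differentiable_l_up[OF w, of 2]]]
  by (simp_all add: m_dn_def[abs_def])


section \<open>The structure equations\<close>

text \<open>These are the weights in eta of F, sqrt g, eta^i and the eta-derivative of F^2: 1/2, 0,
  1 and 0. The other half of the weight of F sits in eta-bar, and hence the halves in the
  homogeneity identities.\<close>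

lemma deriv_0_basic:
  assumes w: "w \<in> S"
  shows "deriv_0 \<phi> w = \<phi> w / 2" "deriv_0 s w = 0" "deriv_0 (\<lambda>y. snd y $ i) w = snd w $ i"
    "deriv_0 (d_eta i LL) w = 0"
proof -
  note D = derivation_at_deriv_0[of w]
  have "deriv_0 LL w = \<phi> w * \<phi> w"
    using euler_LL[OF w] by (simp add: deriv_0_def LL_square)
  then show "deriv_0 \<phi> w = \<phi> w / 2"
    using derivation_\<phi>[OF w D] \<phi>_nonzero[OF w] by simp
  show "deriv_0 s w = 0"
    using derivation_s[OF w D] euler_gd[OF w] by (simp add: deriv_0_def)
  show "deriv_0 (\<lambda>y. snd y $ i) w = snd w $ i"
    by (simp add: deriv_0_def d_eta_fibre_coord sum_kronecker)
  show "deriv_0 (d_eta i LL) w = 0"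
    using euler_deta_LL[OF w] by (simp add: deriv_0_def)
qed

lemma deriv_0_l_up: "w \<in> S \<Longrightarrow> deriv_0 (l_up f i) w = l_up f i w / 2"
  using derivation_l_up[OF _ derivation_at_deriv_0, of w i] \<phi>_nonzero[of w]
  by (simp add: deriv_0_basic l_up_def field_simps)

lemma deriv_0_l_dn: "w \<in> S \<Longrightarrow> deriv_0 (l_dn f i) w = - l_dn f i w / 2"
  using derivation_l_dn[OF _ derivation_at_deriv_0, of w i] \<phi>_nonzero[of w]
  by (simp add: deriv_0_basic)

lemma deriv_0_m_up:
  assumes w: "w \<in> S"
  shows "deriv_0 (m_up f i) w = - m_up f i w / 2"
proof -
  note D = derivation_at_deriv_0[of w]
  have q: "deriv_0 (\<lambda>y. l_dn f j y / s y) w = - (l_dn f j w / s w) / 2" for j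
    using derivation_divide[OF D differentiable_l_dn[OF w] differentiable_s[OF w] s_nonzero[OF w], of j] s_nonzero[OF w]
    by (simp add: deriv_0_basic[OF w] deriv_0_l_dn[OF w] power2_eq_square)
  have "deriv_0 (\<lambda>y. - (l_dn f j y / s y)) w = - deriv_0 (\<lambda>y. l_dn f j y / s y) w" for j
    by (rule derivation_minus[OF D]) (intro differentiable_divide differentiable_l_dn differentiable_s s_nonzero w)
  with q show ?thesis
    by (simp add: m_up_def[abs_def])
qed

lemma deriv_0_JY:
  assumes w: "w \<in> S"
  shows "deriv_0 (fin_JY f) w = fin_JY f w / 2"
proof -
  note D = derivation_at_deriv_0[of w]
  have "deriv_0 (fin_JY f) w = deriv_0 (\<lambda>y. \<Sum>k\<in>UNIV. l_up f k y * \<Lambda> k y) w"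
    by (rule derivation_cong[OF D open_S w]) (simp add: JY_eq)
  also have "\<dots> = (\<Sum>k\<in>UNIV. deriv_0 (l_up f k) w * \<Lambda> k w + l_up f k w * deriv_0 (\<Lambda> k) w)"
    using differentiable_l_up[OF w] differentiable_smooth[OF smooth_\<Lambda> w]
    by (simp add: derivation_sum[OF D] derivation_mult[OF D] differentiable_mult)
  finally show ?thesis
    by (simp add: deriv_0_l_up[OF w] euler_\<Lambda>[OF w] JY_eq[OF w] sum_divide_distrib)
qed

lemma deriv_0_VH:
  assumes w: "w \<in> S"
  shows "deriv_0 (fin_VH f) w = - fin_VH f w / 2"
proof -
  note D = derivation_at_deriv_0[of w]
  have "deriv_0 (fin_VH f) w = deriv_0 (\<lambda>y. \<Sum>k\<in>UNIV. m_up f k y * \<Lambda> k y) w"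
    by (rule derivation_cong[OF D open_S w]) (simp add: VH_eq)
  also have "\<dots> = (\<Sum>k\<in>UNIV. deriv_0 (m_up f k) w * \<Lambda> k w + m_up f k w * deriv_0 (\<Lambda> k) w)"
    using differentiable_m_up[OF w] differentiable_smooth[OF smooth_\<Lambda> w]
    by (simp add: derivation_sum[OF D] derivation_mult[OF D] differentiable_mult)
  finally show ?thesis
    by (simp add: deriv_0_m_up[OF w] euler_\<Lambda>[OF w] VH_eq[OF w] sum_divide_distrib sum_negf)
qed

text \<open>Since m^i l_i = 0, the direction m leaves F fixed; along it ln g grows at rate B, hence
  its root at half that rate.\<close>

lemma deriv_m_basic:
  assumes w: "w \<in> S"
  shows "deriv_m f \<phi> w = 0" "deriv_m f s w = fin_B f w * s w / 2" "deriv_m f (\<lambda>y. snd y $ i) w = m_up f i w"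
    "deriv_m f (d_eta i LL) w = \<phi> w * fin_A f w * m_dn f i w"
proof -
  note D = derivation_at_deriv_m[of w f]
  have "deriv_m f LL w = 0"
    using m_l_contract[of w] \<phi>_nonzero[OF w] by (simp add: deriv_m_def sum_2 deta_LL[OF w] algebra_simps)
      (metis distrib_left mult_zero_right)
  then show "deriv_m f \<phi> w = 0"
    using derivation_\<phi>[OF w D] by simp
  have "deriv_m f gd w = gd w * fin_B f w"
    using gd_nonzero[OF w] by (simp add: deriv_m_def B_eq[OF w] sum_distrib_left)
  then show "deriv_m f s w = fin_B f w * s w / 2"
    using derivation_s[OF w D] s_nonzero[OF w] by (simp flip: s_square)
  show "deriv_m f (\<lambda>y. snd y $ i) w = m_up f i w"
    by (simp add: deriv_m_def d_eta_fibre_coord sum_kronecker)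
  show "deriv_m f (d_eta i LL) w = \<phi> w * fin_A f w * m_dn f i w"
    by (simp add: deriv_m_def m_deta_deta_LL[OF w])
qed

lemma deriv_m_l_dn: "w \<in> S \<Longrightarrow> deriv_m f (l_dn f i) w = fin_A f w * m_dn f i w"
  using derivation_l_dn[OF _ derivation_at_deriv_m, of w f i] \<phi>_nonzero[of w]
  by (simp add: deriv_m_basic)

text \<open>m_i is sqrt g times a rotated l. The root contributes B / 2; the factor l^j has
  derivative m^j / F, and rotating this back gives - l_i / F.\<close>

lemma deriv_m_m_dn:
  assumes w: "w \<in> S"
  shows "deriv_m f (m_dn f i) w = fin_B f w / 2 * m_dn f i w - l_dn f i w / \<phi> w"
proof -
  have "deriv_m f (l_up f j) w = m_up f j w / \<phi> w" for j
    using derivation_l_up[OF w derivation_at_deriv_m, of f j] by (simp add: deriv_m_basic[OF w])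
  then show ?thesis
    using exhaust_2[of i] s_nonzero[OF w] \<phi>_nonzero[OF w]
    by (auto simp: derivation_m_dn[OF w derivation_at_deriv_m] deriv_m_basic[OF w] m_up_def m_dn_def field_simps)
qed

lemma deriv_m_\<Lambda>:
  assumes w: "w \<in> S"
  shows "deriv_m f (\<Lambda> k) w =
    (deriv_m f (fin_JY f) w - fin_VH f w / \<phi> w) * l_dn f k w +
    (deriv_m f (fin_VH f) w + fin_A f w * fin_JY f w + fin_B f w / 2 * fin_VH f w) * m_dn f k w"
proof -
  note D = derivation_at_deriv_m[of w f]
  have "deriv_m f (\<Lambda> k) w = deriv_m f (\<lambda>y. fin_JY f y * l_dn f k y + fin_VH f y * m_dn f k y) w"
    by (rule derivation_cong[OF D open_S w]) (simp add: \<Lambda>_expand)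
  also have "\<dots> = deriv_m f (fin_JY f) w * l_dn f k w + fin_JY f w * deriv_m f (l_dn f k) w +
      (deriv_m f (fin_VH f) w * m_dn f k w + fin_VH f w * deriv_m f (m_dn f k) w)"
    using differentiable_JY[OF w] differentiable_VH[OF w] differentiable_l_dn[OF w] differentiable_m_dn[OF w]
    by (simp add: derivation_add[OF D] derivation_mult[OF D] differentiable_mult)
  finally show ?thesis
    by (simp add: deriv_m_l_dn[OF w] deriv_m_m_dn[OF w] algebra_simps)
qed

lemma delta_basic:
  assumes w: "w \<in> S"
  shows "delta_h f k \<phi> w = 0" "delta_h f k s w = \<Lambda> k w * s w / 2" "delta_h f k (\<lambda>y. snd y $ i) w = - N i k w"
proof -
  note D = derivation_at_delta_h[of w f k]
  show "delta_h f k \<phi> w = 0"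
    using derivation_\<phi>[OF w D] by (simp add: delta_LL[OF w])
  show "delta_h f k s w = \<Lambda> k w * s w / 2"
    using derivation_s[OF w D] s_nonzero[OF w] by (simp add: delta_gd[OF w] flip: s_square)
  show "delta_h f k (\<lambda>y. snd y $ i) w = - N i k w"
    by (simp add: delta_h_def d_z_fibre_coord d_eta_fibre_coord sum_kronecker)
qed

text \<open>delta_k annihilates F, sends eta^i to - N^i_k and multiplies sqrt g by half of the trace
  \<open>\<Lambda> k\<close>. After contraction with m^j the N-terms combine to - l_i N^i_k /
  F.\<close>

lemma m_delta_m_dn:
  assumes w: "w \<in> S"
  shows "(\<Sum>j\<in>UNIV. m_up f j w * delta_h f k (m_dn f j) w) =
    \<Lambda> k w / 2 - (\<Sum>j\<in>UNIV. \<Sum>i\<in>UNIV. l_up f j w * l_dn f i w * d_eta j (N i k) w)"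
proof -
  have l: "delta_h f k (l_up f i) w = - N i k w / \<phi> w" for i
    using derivation_l_up[OF w derivation_at_delta_h, of f k i] by (simp add: delta_basic[OF w])
  have m: "delta_h f k (m_dn f 1) w = \<Lambda> k w / 2 * m_dn f 1 w + s w * N 2 k w / \<phi> w"
    "delta_h f k (m_dn f 2) w = \<Lambda> k w / 2 * m_dn f 2 w - s w * N 1 k w / \<phi> w"
    using derivation_m_dn[OF w derivation_at_delta_h, of f k]
    by (simp_all add: delta_basic[OF w] l m_dn_def)
  have "(\<Sum>j\<in>UNIV. m_up f j w * delta_h f k (m_dn f j) w) =
      \<Lambda> k w / 2 * (m_up f 1 w * m_dn f 1 w + m_up f 2 w * m_dn f 2 w) -
      (l_dn f 1 w * N 1 k w + l_dn f 2 w * N 2 k w) / \<phi> w"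
    using s_nonzero[OF w] \<phi>_nonzero[OF w] by (simp add: sum_2 m m_up_def field_simps)
  also have "\<dots> = \<Lambda> k w / 2 - (l_dn f 1 w * N 1 k w + l_dn f 2 w * N 2 k w) / \<phi> w"
    by (simp add: m_contract[OF w])
  \<comment> \<open>Euler's identity for N^i_k is read backwards, so that the term becomes the
    l-part of a trace and can later join the m-part in \<open>frame_trace\<close>.\<close>
  also have "(l_dn f 1 w * N 1 k w + l_dn f 2 w * N 2 k w) / \<phi> w =
      (\<Sum>i\<in>UNIV. l_dn f i w * (\<Sum>j\<in>UNIV. snd w $ j * d_eta j (N i k) w)) / \<phi> w"
    by (simp only: euler_N[OF w] sum_2)
  also have "\<dots> = (\<Sum>j\<in>UNIV. \<Sum>i\<in>UNIV. l_up f j w * l_dn f i w * d_eta j (N i k) w)"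
    by (simp add: sum_2 l_up_def add_divide_distrib algebra_simps)
  finally show ?thesis .
qed

lemma delta_B:
  assumes w: "w \<in> S"
  shows "delta_h f k (fin_B f) w = deriv_m f (\<Lambda> k) w + fin_B f w * \<Lambda> k w / 2"
proof -
  note D = derivation_at_delta_h[of w f k]
  note B = differentiable_B[OF w] and nz = gd_nonzero[OF w]
  \<comment> \<open>Two computations of the mixed derivative of ln g: its fibre derivative is B m_j,
    its horizontal derivative is \<open>\<Lambda> k\<close>. The sum on the right is their
    commutator.\<close>
  have eq: "delta_h f k (fin_B f) w * m_dn f j w + fin_B f w * delta_h f k (m_dn f j) w =
      d_eta j (\<Lambda> k) w + fin_B f w * (\<Sum>i\<in>UNIV. m_dn f i w * d_eta j (N i k) w)" for j
  proof -
    note Dj = derivation_at_d_eta[of w j]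
    have "d_eta j (\<Lambda> k) w = d_eta j (\<lambda>y. delta_h f k gd y / gd y) w"
      by (rule derivation_cong[OF Dj open_S w]) (simp add: delta_gd gd_nonzero)
    also have "\<dots> = (d_eta j (delta_h f k gd) w * gd w - delta_h f k gd w * d_eta j gd w) / (gd w)\<^sup>2"
    proof (rule derivation_divide[OF Dj])
      have "smooth_on S (\<lambda>w. d_z k gd w - (\<Sum>j\<in>UNIV. N j k w * d_eta j gd w))"
        by (intro smooth_on_diff smooth_on_sum smooth_on_mult open_S smooth_N smooth_basic)
      then show "delta_h f k gd differentiable (at w)"
        by (simp add: delta_h_def[abs_def] differentiable_smooth w)
    qed (intro differentiable_smooth smooth_basic w nz)+
    finally have 1: "d_eta j (\<Lambda> k) w =
      (d_eta j (delta_h f k gd) w * gd w - delta_h f k gd w * d_eta j gd w) / (gd w)\<^sup>2" .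
    have "delta_h f k (fin_B f) w * m_dn f j w + fin_B f w * delta_h f k (m_dn f j) w =
        delta_h f k (\<lambda>y. fin_B f y * m_dn f j y) w"
      using derivation_mult[OF D B differentiable_m_dn[OF w]] by simp
    also have "\<dots> = delta_h f k (\<lambda>y. d_eta j gd y / gd y) w"
      by (rule derivation_cong[OF D open_S w]) (simp add: deta_gd)
    also have "\<dots> = (delta_h f k (d_eta j gd) w * gd w - d_eta j gd w * delta_h f k gd w) / (gd w)\<^sup>2"
      by (rule derivation_divide[OF D]) (intro differentiable_smooth smooth_basic w nz)+
    also have "\<dots> = d_eta j (\<Lambda> k) w + (\<Sum>i\<in>UNIV. d_eta j (N i k) w * (d_eta i gd w / gd w))"
      unfolding 1 delta_deta_commute[OF w smooth_gd] using nz
      by (simp add: sum_2 power2_eq_square field_simps)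
    also have "\<dots> = d_eta j (\<Lambda> k) w + fin_B f w * (\<Sum>i\<in>UNIV. m_dn f i w * d_eta j (N i k) w)"
      unfolding deta_gd[OF w] by (simp add: sum_2 algebra_simps)
    finally show ?thesis .
  qed
  \<comment> \<open>Contraction with m^j isolates the derivative of B because m^j m_j = 1.\<close>
  have "delta_h f k (fin_B f) w * (m_up f 1 w * m_dn f 1 w + m_up f 2 w * m_dn f 2 w) =
      (\<Sum>j\<in>UNIV. m_up f j w * (delta_h f k (fin_B f) w * m_dn f j w + fin_B f w * delta_h f k (m_dn f j) w)) -
      fin_B f w * (\<Sum>j\<in>UNIV. m_up f j w * delta_h f k (m_dn f j) w)"
    by (simp add: sum_2 algebra_simps)
  also have "(\<Sum>j\<in>UNIV. m_up f j w * (delta_h f k (fin_B f) w * m_dn f j w + fin_B f w * delta_h f k (m_dn f j) w)) =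
      deriv_m f (\<Lambda> k) w + fin_B f w * (\<Sum>j\<in>UNIV. \<Sum>i\<in>UNIV. m_up f j w * m_dn f i w * d_eta j (N i k) w)"
    unfolding eq by (simp add: deriv_m_def sum_2 algebra_simps)
  \<comment> \<open>The subtracted term brings in the l-part with a positive sign, which completes
    the m-part to the full trace.\<close>
  also have "deriv_m f (\<Lambda> k) w + fin_B f w * (\<Sum>j\<in>UNIV. \<Sum>i\<in>UNIV. m_up f j w * m_dn f i w * d_eta j (N i k) w) -
      fin_B f w * (\<Sum>j\<in>UNIV. m_up f j w * delta_h f k (m_dn f j) w) =
      deriv_m f (\<Lambda> k) w - fin_B f w * \<Lambda> k w / 2 + fin_B f w *
        ((\<Sum>j\<in>UNIV. \<Sum>i\<in>UNIV. l_up f j w * l_dn f i w * d_eta j (N i k) w) +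
         (\<Sum>j\<in>UNIV. \<Sum>i\<in>UNIV. m_up f j w * m_dn f i w * d_eta j (N i k) w))"
    unfolding m_delta_m_dn[OF w] by (simp add: algebra_simps)
  also have "\<dots> = deriv_m f (\<Lambda> k) w + fin_B f w * \<Lambda> k w / 2"
    unfolding frame_trace[OF w, of "\<lambda>i j. d_eta j (N i k) w"] \<Lambda>_def[symmetric]
    by (simp add: algebra_simps)
  finally show ?thesis
    by (simp add: m_contract[OF w])
qed

lemma delta_B_frame:
  assumes w: "w \<in> S"
  shows "delta_h f k (fin_B f) w =
    (fin_B f w / 2 * fin_JY f w + deriv_m f (fin_JY f) w - 1 / \<phi> w * fin_VH f w) * l_dn f k w +
    (fin_B f w * fin_VH f w + deriv_m f (fin_VH f) w + fin_A f w * fin_JY f w) * m_dn f k w"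
  unfolding delta_B[OF w] deriv_m_\<Lambda>[OF w] \<Lambda>_expand[OF w]
  using \<phi>_nonzero[OF w] by (simp add: field_simps)

lemma frame_independent:
  assumes w: "w \<in> S" and eq: "\<And>k. a * l_dn f k w + b * m_dn f k w = 0"
  shows "a = 0" "b = 0"
proof -
  have "(\<Sum>k\<in>UNIV. l_up f k w * (a * l_dn f k w + b * m_dn f k w)) =
      a * (l_up f 1 w * l_dn f 1 w + l_up f 2 w * l_dn f 2 w)"
    by (simp add: sum_2 m_dn_def algebra_simps)
  then show "a = 0" by (simp add: eq l_contract[OF w])
  have "(\<Sum>k\<in>UNIV. m_up f k w * (a * l_dn f k w + b * m_dn f k w)) =
      b * (m_up f 1 w * m_dn f 1 w + m_up f 2 w * m_dn f 2 w)"
    by (simp add: sum_2 m_up_def algebra_simps)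
  then show "b = 0" by (simp add: eq m_contract[OF w])
qed

lemma identities_if_B_zero:
  assumes B: "\<And>y. y \<in> S \<Longrightarrow> fin_B f y = 0" and w: "w \<in> S"
  shows "deriv_m f (fin_JY f) w = 1 / \<phi> w * fin_VH f w"
    "deriv_m f (fin_VH f) w = - fin_A f w * fin_JY f w"
proof -
  note D = derivation_at_delta_h[of w f]
  have "delta_h f k (fin_B f) w = 0" for k
    using derivation_cong[OF D open_S w, of "fin_B f" "\<lambda>_. 0" k] derivation_const[OF D, of k 0] B by simp
  then have "(deriv_m f (fin_JY f) w - 1 / \<phi> w * fin_VH f w) * l_dn f k w +
    (deriv_m f (fin_VH f) w + fin_A f w * fin_JY f w) * m_dn f k w = 0" for k
    using delta_B_frame[OF w, of k] B[OF w] by simp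
  from frame_independent[OF w this]
  show "deriv_m f (fin_JY f) w = 1 / \<phi> w * fin_VH f w" "deriv_m f (fin_VH f) w = - fin_A f w * fin_JY f w"
    by (simp_all add: eq_neg_iff_add_eq_0)
qed


section \<open>Vanishing of the scalars A and B\<close>

text \<open>\<open>A\<close> carries the whole second \<open>\<eta>\<close>-derivative of the square of the Finsler function, and
  differentiating that by \<open>\<eta>\<close>-bar gives the whole \<open>\<eta>\<close>-derivative of the fundamental tensor.\<close>

lemma deta_g_zero_if_A_zero:
  assumes "open T" "T \<subseteq> S" "w \<in> T" and A: "\<And>y. y \<in> T \<Longrightarrow> fin_A f y = 0"
  shows "d_eta k (g i j) w = 0"
proof -
  have w: "w \<in> S" using assms by auto
  note D = derivation_at_d_etabar[of w j]
  have i: "d_eta i (d_etabar j LL) y = d_etabar j (d_eta i LL) y" if "y \<in> S" for y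
    by (rule d_eta_d_etabar_commute[OF open_S that smooth_LL])
  have "d_eta k (g i j) w = d_eta k (d_etabar j (d_eta i LL)) w"
    unfolding g_LL by (rule derivation_cong[OF derivation_at_d_eta open_S w i])
  also have "\<dots> = d_etabar j (d_eta k (d_eta i LL)) w"
    by (rule d_eta_d_etabar_commute[OF open_S w smooth_deta[OF smooth_LL]])
  \<comment> \<open>Here A must vanish on an open set and not just at \<open>w\<close>, since the
    vanishing second derivative is differentiated once more.\<close>
  also have "\<dots> = d_etabar j (\<lambda>y. 0) w"
    by (rule derivation_cong[OF D assms(1,3)]) (use A assms(2) deta_deta_LL in auto)
  also have "\<dots> = 0" by (rule derivation_const[OF D])
  finally show ?thesis .
qed

lemma B_zero_if_A_zero:
  assumes "open T" "T \<subseteq> S" "w \<in> T" and A: "\<And>y. y \<in> T \<Longrightarrow> fin_A f y = 0"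
  shows "fin_B f w = 0"
  using deta_g_zero_if_A_zero[OF assms] by (simp add: fin_B_def C_conn_def)

lemma A_B_nonzero:
  assumes w: "w \<in> S" and B: "fin_B f w \<noteq> 0"
  shows "\<exists>y\<in>S. fin_A f y \<noteq> 0 \<and> fin_B f y \<noteq> 0"
proof (rule ccontr)
  assume *: "\<not> ?thesis"
  obtain e where e: "e > 0" "\<And>y. dist w y < e \<Longrightarrow> fin_B f y \<noteq> 0"
    using continuous_at_avoid[OF differentiable_imp_continuous_within[OF differentiable_B[OF w]] B] by blast
  \<comment> \<open>B has no zero in this ball, so the negated claim makes A vanish on its part
    inside \<open>S\<close>.\<close>
  have "fin_B f w = 0"
    by (rule B_zero_if_A_zero[of "S \<inter> ball w e"]) (use open_S w e * in auto)
  with B show False by simp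
qed

lemma g_fibre_constant:
  assumes A: "\<And>y. y \<in> S \<Longrightarrow> fin_A f y = 0" and w: "(z, \<eta>) \<in> S" "(z, \<eta>') \<in> S"
  shows "g i j (z, \<eta>) = g i j (z, \<eta>')"
proof -
  have zero: "d_eta k (g i j) y = 0" if "y \<in> S" for i j k y
    using deta_g_zero_if_A_zero[OF open_S order_refl that A] .
  \<comment> \<open>Hermitian symmetry turns the eta-bar derivative of one entry into the conjugate
    of the eta-derivative of the transposed entry.\<close>
  have zero': "d_etabar k (g i j) y = 0" if y: "y \<in> S" for i j k y
  proof -
    have "d_etabar k (g i j) y = d_etabar k (\<lambda>x. cnj (g j i x)) y"
      by (rule derivation_cong[OF derivation_at_d_etabar open_S y]) (simp add: cnj_g)
    also have "\<dots> = cnj (d_eta k (g j i) y)"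
      by (rule d_etabar_cnj[OF differentiable_smooth[OF smooth_g y]])
    finally show ?thesis using zero[OF y] by simp
  qed
  have fibre: "((\<lambda>\<eta>. g i j (z, \<eta>)) has_derivative (\<lambda>v. 0)) (at \<eta>)" if "\<eta> \<in> - {0}" for \<eta>
  proof -
    have y: "(z, \<eta>) \<in> S" using that w by (simp add: S_def)
    have d: "g i j differentiable (at (z, \<eta>))" by (rule differentiable_smooth[OF smooth_g y])
    let ?D = "frechet_derivative (g i j) (at (z, \<eta>))"
    have lin: "linear ?D" using d by (rule linear_frechet_derivative)
    have "?D (0, axis k 1) = d_eta k (g i j) (z, \<eta>) + d_etabar k (g i j) (z, \<eta>)"
      "?D (0, axis k \<i>) = \<i> * (d_eta k (g i j) (z, \<eta>) - d_etabar k (g i j) (z, \<eta>))" for k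
      by (simp_all add: d_eta_def d_etabar_def field_simps)
    then have "?D (0, v) = 0" for v
      using linear_fibre_expand[OF lin, of v] zero[OF y] zero'[OF y] by simp
    moreover have "((\<lambda>\<eta>. (z, \<eta>)) has_derivative (\<lambda>v. (0, v))) (at \<eta>)"
      by (auto intro!: derivative_eq_intros)
    ultimately show ?thesis
      using diff_chain_at[of "\<lambda>\<eta>. (z, \<eta>)" "\<lambda>v. (0, v)" \<eta> "g i j" ?D] d frechet_derivative_works
      by (fastforce simp: o_def)
  qed
  \<comment> \<open>The fibre without its origin is connected because its real dimension is 4, so a
    vanishing derivative forces constancy on the whole fibre.\<close>
  have "connected (- {0 :: complex^2})"
    by (rule connected_punctured_universe) simp
  moreover have "open (- {0 :: complex^2})"
    by (simp add: open_Compl)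
  ultimately show ?thesis
    using has_derivative_zero_unique_connected[of "- {0}" "\<lambda>\<eta>. g i j (z, \<eta>)" \<eta> \<eta>'] fibre w
    by (simp add: S_def)
qed

end



section \<open>Passage to charts\<close>

context complex_finsler_space
begin

lemma chart_inv_in: "z \<in> chart_image c \<Longrightarrow> chart_inv c z \<in> fst c \<and> snd c (chart_inv c z) = z"
  unfolding chart_image_def chart_inv_def by (simp add: inv_into_into f_inv_into_f)

text \<open>Homogeneity of F concerns all components of a tangent vector at once. Transition
  derivatives are complex linear, so scaling eta in one chart scales the components in every
  chart.\<close>

lemma induced_param_scale:
  assumes c: "c \<in> \<A>" and z: "z \<in> chart_image c"
  shows "induced_param \<A> c (z, a *s \<eta>) = (chart_inv c z, \<lambda>d. a *s snd (induced_param \<A> c (z, \<eta>)) d)"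
proof -
  have "frechet_derivative (transition c d) (at z) (a *s \<eta>) = a *s frechet_derivative (transition c d) (at z) \<eta>"
    if d: "d \<in> \<A>" "chart_inv c z \<in> fst d" for d
  proof -
    have "z \<in> snd c ` (fst c \<inter> fst d)"
      using chart_inv_in[OF z] d(2) by (metis IntI image_eqI)
    then obtain D where D: "(transition c d has_derivative D) (at z)" "\<forall>b v. D (b *s v) = b *s D v"
      using compatible[OF c d(1)] unfolding compatible_charts_def holomorphic_map_on_def by blast
    then show ?thesis by (simp flip: frechet_derivative_at[OF D(1)])
  qed
  then show ?thesis by (auto simp: induced_param_def)
qed

lemma induced_param_in: "c \<in> \<A> \<Longrightarrow> z \<in> chart_image c \<Longrightarrow> induced_param \<A> c (z, \<eta>) \<in> tangent_bundle X \<A>"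
  using bij_betwE[OF induced_param_bij, of c] by blast

lemma induced_param_eq: "induced_param \<A> c (z, \<eta>) = (chart_inv c z, snd (induced_param \<A> c (z, \<eta>)))"
  by (simp add: induced_param_def)

lemma local_expr_pos:
  assumes c: "c \<in> \<A>" and w: "(z, \<eta>) \<in> slit_coords c"
  shows "0 < local_expr \<A> F c (z, \<eta>)"
proof -
  have z: "z \<in> chart_image c" and \<eta>: "\<eta> \<noteq> 0" using w by (simp_all add: slit_coords_def)
  let ?v = "snd (induced_param \<A> c (z, \<eta>))"
  have m: "(chart_inv c z, ?v) \<in> tangent_bundle X \<A>"
    using induced_param_in[OF c z, of \<eta>] induced_param_eq[of c z \<eta>] by simp
  have "?v \<noteq> (\<lambda>_. 0)"
  proof
    assume "?v = (\<lambda>_. 0)"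
    \<comment> \<open>The zero vector is the image of 0 times eta, so injectivity of the induced
      chart would force eta = 0.\<close>
    then have "induced_param \<A> c (z, \<eta>) = induced_param \<A> c (z, 0 *s \<eta>)"
      unfolding induced_param_scale[OF c z] using induced_param_eq[of c z \<eta>] by simp
    moreover have "inj_on (induced_param \<A> c) (chart_image c \<times> UNIV)"
      using induced_param_bij[OF c] by (rule bij_betw_imp_inj_on)
    ultimately have "(z, \<eta>) = (z, 0 *s \<eta>)"
      using z unfolding inj_on_def by blast
    with \<eta> show False by simp
  qed
  then have "F (chart_inv c z, ?v) \<noteq> 0" using zero_iff[OF m] by simp
  with nonneg[OF m] show ?thesis
    using induced_param_eq[of c z \<eta>] by (simp add: local_expr_def)
qed

lemma local_expr_scale:
  assumes c: "c \<in> \<A>" and z: "z \<in> chart_image c"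
  shows "local_expr \<A> F c (z, a *s \<eta>) = cmod a * local_expr \<A> F c (z, \<eta>)"
proof -
  let ?v = "snd (induced_param \<A> c (z, \<eta>))"
  have m: "(chart_inv c z, ?v) \<in> tangent_bundle X \<A>"
    using induced_param_in[OF c z, of \<eta>] induced_param_eq[of c z \<eta>] by simp
  from homogeneous[OF m, of a] show ?thesis
    using induced_param_eq[of c z \<eta>] by (simp add: local_expr_def induced_param_scale[OF c z])
qed

end

lemma coordinate_finsler_chart:
  assumes "complex_finsler_space X (\<A> :: ('a, 2) chart set) F" and c: "c \<in> \<A>"
  shows "coordinate_finsler (chart_image c) (local_expr \<A> F c)"
proof -
  interpret complex_finsler_space X \<A> F by fact
  show ?thesis
  proof
    show "open (chart_image c)" using charts[OF c] by (simp add: is_chart_def)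
    show "smooth_on (chart_image c \<times> (UNIV - {0})) (\<lambda>w. (local_expr \<A> F c w)\<^sup>2)"
      using smooth[OF c] by (simp add: slit_coords_def)
    show "0 < local_expr \<A> F c w" if "w \<in> chart_image c \<times> (UNIV - {0})" for w
      using local_expr_pos[OF c, of "fst w" "snd w"] that by (simp add: slit_coords_def)
    show "local_expr \<A> F c (z, a *s \<eta>) = cmod a * local_expr \<A> F c (z, \<eta>)"
      if "z \<in> chart_image c" for z a \<eta>
      by (rule local_expr_scale[OF c that])
    show "hermitian_pos_def (fund_matrix (local_expr \<A> F c) w)" if "w \<in> chart_image c \<times> (UNIV - {0})" for w
      using pos_def[OF c, of w] that by (simp add: slit_coords_def)
  qed
qed

theorem theorem4p2:
  fixes X :: "'a topology" and \<A> :: "('a, 2) chart set" and F :: "('a, 2) tangent \<Rightarrow> real"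
  assumes "complex_finsler_space X \<A> F"
  shows "purely_hermitian \<A> F
    \<or> ((\<exists>c\<in>\<A>. \<exists>w\<in>slit_coords c. fin_A (local_expr \<A> F c) w \<noteq> 0)
       \<and> (\<forall>c\<in>\<A>. \<forall>w\<in>slit_coords c. fin_B (local_expr \<A> F c) w = 0)
       \<and> (\<forall>c\<in>\<A>. \<forall>w\<in>slit_coords c. let f = local_expr \<A> F c in
            deriv_m f (fin_JY f) w = 1 / complex_of_real (f w) * fin_VH f w
          \<and> deriv_m f (fin_VH f) w = - fin_A f w * fin_JY f w))
    \<or> ((\<exists>c\<in>\<A>. \<exists>w\<in>slit_coords c.
          fin_A (local_expr \<A> F c) w * (fin_B (local_expr \<A> F c) w)\<^sup>2 \<noteq> 0)
       \<and> (\<forall>c\<in>\<A>. \<forall>w\<in>slit_coords c. let f = local_expr \<A> F c in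
            deriv_0 (fin_JY f) w = fin_JY f w / 2
          \<and> deriv_0 (fin_VH f) w = - fin_VH f w / 2
          \<and> (\<forall>k. delta_h f k (fin_B f) w =
                (fin_B f w / 2 * fin_JY f w + deriv_m f (fin_JY f) w
                   - 1 / complex_of_real (f w) * fin_VH f w) * l_dn f k w
              + (fin_B f w * fin_VH f w + deriv_m f (fin_VH f) w
                   + fin_A f w * fin_JY f w) * m_dn f k w)))"
proof -
  note chart = coordinate_finsler_chart[OF assms]
  have S: "coordinate_finsler.S (chart_image c) = slit_coords c" if "c \<in> \<A>" for c
    by (simp add: coordinate_finsler.S_def[OF chart[OF that]] slit_coords_def)
  show ?thesis
  proof (cases "\<forall>c\<in>\<A>. \<forall>w\<in>slit_coords c. fin_A (local_expr \<A> F c) w = 0")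
    case A: True
    have "fund_tensor (local_expr \<A> F c) i j (z, \<eta>) = fund_tensor (local_expr \<A> F c) i j (z, \<eta>')"
      if "c \<in> \<A>" "(z, \<eta>) \<in> slit_coords c" "(z, \<eta>') \<in> slit_coords c" for c z \<eta> \<eta>' i j
      using that(1) A
      by (intro coordinate_finsler.g_fibre_constant[OF chart[OF that(1)], unfolded S[OF that(1)], OF _ that(2,3)])
        simp
    then have "purely_hermitian \<A> F"
      unfolding purely_hermitian_def fund_matrix_def vec_eq_iff vec_lambda_beta by blast
    then show ?thesis by simp
  next
    case A: False
    show ?thesis
    proof (cases "\<forall>c\<in>\<A>. \<forall>w\<in>slit_coords c. fin_B (local_expr \<A> F c) w = 0")
      case B: True
      have "let f = local_expr \<A> F c in
            deriv_m f (fin_JY f) w = 1 / complex_of_real (f w) * fin_VH f w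
          \<and> deriv_m f (fin_VH f) w = - fin_A f w * fin_JY f w"
        if "c \<in> \<A>" "w \<in> slit_coords c" for c w
        unfolding Let_def using that(1) B
        by (intro conjI coordinate_finsler.identities_if_B_zero[OF chart[OF that(1)], unfolded S[OF that(1)], OF _ that(2)])
          simp_all
      with A B show ?thesis by blast
    next
      case False
      then obtain c w where c: "c \<in> \<A>" "w \<in> slit_coords c" "fin_B (local_expr \<A> F c) w \<noteq> 0"
        by blast
      have AB: "\<exists>c\<in>\<A>. \<exists>w\<in>slit_coords c. fin_A (local_expr \<A> F c) w * (fin_B (local_expr \<A> F c) w)\<^sup>2 \<noteq> 0"
        using coordinate_finsler.A_B_nonzero[OF chart[OF c(1)], unfolded S[OF c(1)], OF c(2,3)] c(1) by auto
      have "let f = local_expr \<A> F c in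
            deriv_0 (fin_JY f) w = fin_JY f w / 2
          \<and> deriv_0 (fin_VH f) w = - fin_VH f w / 2
          \<and> (\<forall>k. delta_h f k (fin_B f) w =
                (fin_B f w / 2 * fin_JY f w + deriv_m f (fin_JY f) w
                   - 1 / complex_of_real (f w) * fin_VH f w) * l_dn f k w
              + (fin_B f w * fin_VH f w + deriv_m f (fin_VH f) w
                   + fin_A f w * fin_JY f w) * m_dn f k w)"
        if "c \<in> \<A>" "w \<in> slit_coords c" for c w
        using coordinate_finsler.deriv_0_JY[OF chart[OF that(1)], unfolded S[OF that(1)], OF that(2)]
          coordinate_finsler.deriv_0_VH[OF chart[OF that(1)], unfolded S[OF that(1)], OF that(2)]
          coordinate_finsler.delta_B_frame[OF chart[OF that(1)], unfolded S[OF that(1)], OF that(2)]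
        unfolding Let_def by blast
      with AB show ?thesis by blast
    qed
  qed
qed

end
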